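(* Let $\Omega\subset\mathbb{C}^n$ be a smoothly bounded domain, and let $\delta$ be the signed distance function to $b\Omega$ (negative in $\Omega$). Suppose that $\delta$ is $\gamma$-plurisubharmonic on $b\Omega$ for some $\gamma>0$. Let $\eta=1-\frac{2}{2+\gamma^2}$. Then there exists a neighborhood $U$ of $b\Omega$ such that $$\mathcal{L}_{-(-\delta)^{\eta}(z)}(V,V)\geq 0\qquad\text{for all } z\in U\cap\Omega \text{ and all } V\in\mathbb{C}^n,$$ where $\mathcal{L}_{-(-\delta)^\eta(z)}$ denotes the complex Hessian of the function $-(-\delta)^\eta$ at $z$.
   Context: A smoothly bounded domain $\Omega\subset\mathbb{C}^n$ is a bounded domain with smooth ($C^\infty$) boundary $b\Omega$. A local defining function for $\Omega$ in a neighborhood $U$ of $p\in b\Omega$ is a real-valued $r\in C^\infty(U)$ with $U\cap\Omega=\{z\in U: r(z)<0\}$ and $\nabla r(z)\neq 0$ for $z\in U$. Identify $\mathbb{C}^n$ with $\mathbb{R}^{2n}$ via $z_k=x_{2k-1}+i\,x_{2k}$, $k=1,\dots,n$; a vector $(a_1,\dots,a_{2n})\in\mathbb{R}^{2n}$ is identified with $(a_1+ia_2,\dots,a_{2n-1}+ia_{2n})\in\mathbb{C}^n$. Let $\langle\cdot,\cdot\rangle$ be the standard real inner product on $\mathbb{R}^{2n}$ and $\|\cdot\|$ the Euclidean norm. The real gradient $\nabla r(p)\in\mathbb{R}^{2n}$ is viewed in $\mathbb{C}^n$ by this identification, and $i\nabla r(p)$ is its multiplication by $i=\sqrt{-1}$.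 The real tangent space to $b\Omega$ at $p\in b\Omega$ is $\mathbb{R}T_p(b\Omega)=\{W\in\mathbb{R}^{2n}:\langle\nabla r(p),W\rangle=0\}$. For $\gamma\in[0,\infty)$ and $p\in b\Omega$, with $r$ a defining function near $p$, define the cone $$\mathbb{R}T_p^{\gamma}(b\Omega)=\left\{V\in\mathbb{R}T_p(b\Omega):\ \frac{|\langle i\nabla r(p),V\rangle|}{\|\nabla r(p)\|}\leq\gamma\left\|V-\frac{\langle i\nabla r(p),V\rangle\, i\nabla r(p)}{\|\nabla r(p)\|^2}\right\|\right\},$$ which is independent of the choice of $r$. For a $C^2$ function $f$, the complex Hessian at $p$ is $\mathcal{L}_{f(p)}(A,B)=\sum_{k,\ell=1}^n \frac{\partial^2 f}{\partial z_k\partial\bar z_\ell}(p)A_k\overline{B}_\ell$ for $A,B\in\mathbb{C}^n$. The signed distance function is $\delta(z)=-d(z)$ for $z\in\Omega$ and $\delta(z)=d(z)$ for $z\in\mathbb{C}^n\setminus\Omega$, where $d(z)=\inf_{q\in b\Omega}\|z-q\|$ is the Euclidean distance to $b\Omega$. It is smooth in some neighborhood of $b\Omega$. $\delta$ is called $\gamma$-plurisubharmonic on $b\Omega$ if $\mathcal{L}_{\delta(p)}(V,V)\geq 0$ for all $p\in b\Omega$ and all $V\in\mathbb{R}T_p^{\gamma}(b\Omega)$. *)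

theory Defs
  imports "HOL-Analysis.Analysis" "HOL-Library.Complex_Order"
begin

text \<open>
  Complex $n$-space is \<^typ>\<open>complex ^ 'n\<close>. Its library inner product
  \<open>x \<bullet> y = (\<Sum>k\<in>UNIV. Re (x $ k) * Re (y $ k) + Im (x $ k) * Im (y $ k))\<close> and its norm are the real
  Euclidean ones of $\mathbb{R}^{2n}$, and \<open>\<i> *s v\<close> is multiplication of a vector by the imaginary unit.
\<close>

text \<open>
  \<open>C_k_on k U f\<close> means that \<open>f\<close> is of class $C^k$ on \<open>U\<close>; it is meant for open \<open>U\<close>,
  since the derivatives are the unrestricted ones.
\<close>

fun C_k_on :: "nat \<Rightarrow> 'a::real_normed_vector set \<Rightarrow> ('a \<Rightarrow> 'b::real_normed_vector) \<Rightarrow> bool" where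
  "C_k_on 0 U f \<longleftrightarrow> continuous_on U f"
| "C_k_on (Suc k) U f \<longleftrightarrow>
     (\<forall>x\<in>U. f differentiable (at x)) \<and>
     (\<forall>v. C_k_on k U (\<lambda>x. frechet_derivative f (at x) v))"

definition smooth_on :: "'a::real_normed_vector set \<Rightarrow> ('a \<Rightarrow> 'b::real_normed_vector) \<Rightarrow> bool" where
  "smooth_on U f \<longleftrightarrow> (\<forall>k. C_k_on k U f)"

definition gradient :: "('a::real_inner \<Rightarrow> real) \<Rightarrow> 'a \<Rightarrow> 'a" where
  "gradient f x = (THE D. GDERIV f x :> D)"

definition local_defining_function ::
  "'a::real_inner set \<Rightarrow> 'a \<Rightarrow> 'a set \<Rightarrow> ('a \<Rightarrow> real) \<Rightarrow> bool" where
  "local_defining_function \<Omega> p U r \<longleftrightarrow>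
     open U \<and> p \<in> U \<and> smooth_on U r \<and>
     U \<inter> \<Omega> = {z \<in> U. r z < 0} \<and>
     (\<forall>z\<in>U. gradient r z \<noteq> 0)"

definition smoothly_bounded_domain :: "'a::real_inner set \<Rightarrow> bool" where
  "smoothly_bounded_domain \<Omega> \<longleftrightarrow>
     open \<Omega> \<and> connected \<Omega> \<and> \<Omega> \<noteq> {} \<and> bounded \<Omega> \<and>
     (\<forall>p\<in>frontier \<Omega>. \<exists>U r. local_defining_function \<Omega> p U r)"

definition real_tangent_space :: "('a::real_inner \<Rightarrow> real) \<Rightarrow> 'a \<Rightarrow> 'a set" where
  "real_tangent_space r p = {W. gradient r p \<bullet> W = 0}"

text \<open>
  The cone does not depend on the choice of the local defining function \<open>r\<close> (two such functions
  have positively proportional gradients at \<open>p\<close>), so the existential quantifier below only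
  selects an arbitrary one.
\<close>

definition tangent_cone :: "(complex ^ 'n) set \<Rightarrow> real \<Rightarrow> complex ^ 'n \<Rightarrow> (complex ^ 'n) set" where
  "tangent_cone \<Omega> \<gamma> p =
     {V. \<exists>U r. local_defining_function \<Omega> p U r \<and>
           V \<in> real_tangent_space r p \<and>
           \<bar>(\<i> *s gradient r p) \<bullet> V\<bar> / norm (gradient r p)
             \<le> \<gamma> * norm (V - (((\<i> *s gradient r p) \<bullet> V) / (norm (gradient r p))\<^sup>2)
                                *\<^sub>R (\<i> *s gradient r p))}"

text \<open>
  The Wirtinger derivatives
  $\partial/\partial z_k = \frac12(\partial/\partial x - i\,\partial/\partial y)$ and
  $\partial/\partial \bar z_k = \frac12(\partial/\partial x + i\,\partial/\partial y)$ for $z_k = x + iy$.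
\<close>

definition wirtinger :: "'n \<Rightarrow> (complex ^ 'n \<Rightarrow> complex) \<Rightarrow> complex ^ 'n \<Rightarrow> complex" where
  "wirtinger k f p =
     (frechet_derivative f (at p) (axis k 1) - \<i> * frechet_derivative f (at p) (axis k \<i>)) / 2"

definition wirtinger_bar :: "'n \<Rightarrow> (complex ^ 'n \<Rightarrow> complex) \<Rightarrow> complex ^ 'n \<Rightarrow> complex" where
  "wirtinger_bar k f p =
     (frechet_derivative f (at p) (axis k 1) + \<i> * frechet_derivative f (at p) (axis k \<i>)) / 2"

definition complex_hessian ::
  "(complex ^ 'n \<Rightarrow> real) \<Rightarrow> complex ^ 'n \<Rightarrow> complex ^ 'n \<Rightarrow> complex ^ 'n \<Rightarrow> complex" where
  "complex_hessian f p A B =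
     (\<Sum>k\<in>UNIV. \<Sum>l\<in>UNIV.
        wirtinger k (wirtinger_bar l (\<lambda>z. complex_of_real (f z))) p * A $ k * cnj (B $ l))"

definition signed_distance :: "'a::metric_space set \<Rightarrow> 'a \<Rightarrow> real" where
  "signed_distance \<Omega> z =
     (if z \<in> \<Omega> then - infdist z (frontier \<Omega>) else infdist z (frontier \<Omega>))"

text \<open>
  Below, \<open>0 \<le> w\<close> for complex \<open>w\<close> means that \<open>w\<close> is real and nonnegative. Reality is automatic
  for the complex Hessian form of a real $C^2$ function on the diagonal.
\<close>

definition gamma_plurisubharmonic :: "real \<Rightarrow> (complex ^ 'n) set \<Rightarrow> bool" where
  "gamma_plurisubharmonic \<gamma> \<Omega> \<longleftrightarrow>
     (\<forall>p\<in>frontier \<Omega>. \<forall>V\<in>tangent_cone \<Omega> \<gamma> p.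
        0 \<le> complex_hessian (signed_distance \<Omega>) p V V)"

end

theory Submission
  imports Defs
begin

text \<open>
  Near \<open>b\<Omega>\<close> the signed distance \<open>\<delta>\<close> is twice differentiable, by the inverse function theorem applied to
  \<open>(x, s) \<mapsto> (x + s \<nu>(x), r(x))\<close>. Let \<open>z \<in> \<Omega>\<close> have nearest boundary point \<open>p\<close>, and put \<open>t = -\<delta>(z)\<close>.
  As \<open>\<delta>\<close> is 1-Lipschitz, \<open>\<delta>(p + h) \<le> \<delta>(z + h) + t\<close> with equality at \<open>h = 0\<close>, so the
  gradients at \<open>z\<close> and \<open>p\<close> agree and the Hessian at \<open>z\<close> dominates the one at \<open>p\<close>. Up to a positive
  factor, the complex Hessian of \<open>-(-\<delta>)\<^sup>\<eta>\<close> at \<open>z\<close> is \<open>t Q\<^sub>z(A) + (1 - \<eta>) \<bar>c\<bar>\<^sup>2\<close>, where \<open>A = c \<nu> + W\<close>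
  and \<open>Q\<^sub>z \<ge> Q\<^sub>p\<close>. If \<open>\<bar>c\<bar> \<le> \<gamma> \<parallel>W\<parallel>\<close>, a unimodular multiple of \<open>A\<close> lies in the cone at \<open>p\<close>, hence
  \<open>Q\<^sub>p(A) \<ge> 0\<close>. Otherwise \<open>\<parallel>A\<parallel>\<^sup>2\<close> is bounded by a multiple of \<open>\<bar>c\<bar>\<^sup>2\<close> and the second term dominates
  for small \<open>t\<close>.
\<close>

section \<open>Gradients and second derivatives\<close>

lemma GDERIV_unique:
  assumes "GDERIV f x :> D" "GDERIV f x :> D'"
  shows "D = D'"
proof -
  have "(\<lambda>h. h \<bullet> D) = (\<lambda>h. h \<bullet> D')"
    using assms unfolding gderiv_def by (rule has_derivative_unique)
  then show ?thesis
    by (metis vector_eq_rdot inner_commute)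
qed

lemma gradient_eqI: "GDERIV f x :> D \<Longrightarrow> gradient f x = D"
  unfolding gradient_def by (blast intro: GDERIV_unique)

text \<open>\<open>C_k_on\<close> only provides derivatives along fixed directions, so the gradient
  and its derivative are assembled over \<open>Basis\<close>. The derivative is packaged as a
  \<open>blinfun\<close> because the inverse function theorem asks for a continuous map into that
  type.\<close>

lemma smooth_gradient:
  fixes r :: "'a::euclidean_space \<Rightarrow> real"
  assumes "open U" "smooth_on U r"
  obtains g' where "\<And>x. x \<in> U \<Longrightarrow> GDERIV r x :> gradient r x"
    and "\<And>x. x \<in> U \<Longrightarrow> (gradient r has_derivative blinfun_apply (g' x)) (at x)"
    and "continuous_on U g'"
proof -
  define G where "G x = (\<Sum>b\<in>Basis. frechet_derivative r (at x) b *\<^sub>R b)" for x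
  define D where "D x h = (\<Sum>b\<in>Basis. frechet_derivative (\<lambda>y. frechet_derivative r (at y) b) (at x) h *\<^sub>R b)"
    for x h
  have "C_k_on (Suc (Suc 0)) U r"
    using assms(2) unfolding smooth_on_def by blast
  then have d1: "\<And>x. x \<in> U \<Longrightarrow> r differentiable (at x)"
    and d2: "\<And>v x. x \<in> U \<Longrightarrow> (\<lambda>y. frechet_derivative r (at y) v) differentiable (at x)"
    and c2: "\<And>v w. continuous_on U (\<lambda>x. frechet_derivative (\<lambda>y. frechet_derivative r (at y) v) (at x) w)"
    by auto
  have gd: "GDERIV r x :> G x" if "x \<in> U" for x
  proof -
    have fd: "(r has_derivative frechet_derivative r (at x)) (at x)"
      using d1[OF that] frechet_derivative_works by blast
    then have lin: "linear (frechet_derivative r (at x))"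
      by (rule has_derivative_linear)
    have "frechet_derivative r (at x) h = h \<bullet> G x" for h
    proof -
      have "frechet_derivative r (at x) h = frechet_derivative r (at x) (\<Sum>b\<in>Basis. (h \<bullet> b) *\<^sub>R b)"
        by (simp add: euclidean_representation)
      also have "\<dots> = (\<Sum>b\<in>Basis. (h \<bullet> b) *\<^sub>R frechet_derivative r (at x) b)"
        using lin by (simp add: linear_sum linear_cmul)
      also have "\<dots> = h \<bullet> G x"
        by (simp add: G_def inner_sum_right mult.commute)
      finally show ?thesis .
    qed
    then have "frechet_derivative r (at x) = (\<lambda>h. h \<bullet> G x)"
      by blast
    then show ?thesis
      using fd by (simp add: gderiv_def)
  qed
  then have eq: "gradient r x = G x" if "x \<in> U" for x
    using gradient_eqI that by blast
  have GD: "(G has_derivative D x) (at x)" if "x \<in> U" for x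
    unfolding G_def D_def
    by (intro has_derivative_sum has_derivative_scaleR_left)
       (use d2[OF that] frechet_derivative_works in blast)
  have bl: "blinfun_apply (Blinfun (D x)) = D x" if "x \<in> U" for x
    using GD[OF that] by (auto intro: bounded_linear_Blinfun_apply has_derivative_bounded_linear)
  show ?thesis
  proof
    show "GDERIV r x :> gradient r x" if "x \<in> U" for x
      using gd eq that by simp
    show "(gradient r has_derivative blinfun_apply (Blinfun (D x))) (at x)" if "x \<in> U" for x
      using has_derivative_transform_within_open[OF GD[OF that] assms(1) that] eq bl[OF that] by simp
    show "continuous_on U (\<lambda>x. Blinfun (D x))"
    proof (rule continuous_on_blinfun_componentwise)
      fix i :: 'a
      have "continuous_on U (\<lambda>x. D x i)"
        unfolding D_def by (intro continuous_intros c2)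
      then show "continuous_on U (\<lambda>x. blinfun_apply (Blinfun (D x)) i)"
        using bl by (simp cong: continuous_on_cong)
    qed
  qed
qed

lemma has_derivative_normalized:
  fixes g :: "'a::real_normed_vector \<Rightarrow> 'b::real_inner"
  assumes "(g has_derivative g') (at x)" "g x \<noteq> 0"
  shows "((\<lambda>x. (1 / norm (g x)) *\<^sub>R g x) has_derivative
          (\<lambda>h. (1 / norm (g x)) *\<^sub>R g' h - ((g x \<bullet> g' h) / norm (g x) ^ 3) *\<^sub>R g x)) (at x)"
proof -
  have n: "((\<lambda>x. norm (g x)) has_derivative (\<lambda>h. g' h \<bullet> sgn (g x))) (at x)"
    using has_derivative_compose[OF assms(1) has_derivative_norm[OF assms(2)]] .
  show ?thesis
    by (rule has_derivative_eq_rhs,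
        rule has_derivative_scaleR[OF has_derivative_divide[OF has_derivative_const n] assms(1)])
       (use assms(2) in \<open>auto simp: fun_eq_iff sgn_div_norm inner_commute field_simps power3_eq_cube\<close>)
qed

text \<open>The second difference quotient \<open>(f(z+su+sv) - f(z+su) - f(z+sv) + f(z)) / s\<^sup>2\<close> is symmetric in
  \<open>u\<close> and \<open>v\<close> and tends to \<open>H v \<bullet> u\<close>.\<close>

lemma gradient_derivative_symmetric:
  fixes f :: "'a::real_inner \<Rightarrow> real"
  assumes "open N" "z \<in> N" and f: "\<And>w. w \<in> N \<Longrightarrow> GDERIV f w :> n w"
    and n: "(n has_derivative H) (at z)"
  shows "H u \<bullet> v = H v \<bullet> u"
proof -
  have lin: "linear H" using n by (rule has_derivative_linear)
  define \<Delta> where "\<Delta> s u v = f (z + s *\<^sub>R u + s *\<^sub>R v) - f (z + s *\<^sub>R u) - f (z + s *\<^sub>R v) + f z"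
    for s u v
  have est: "\<exists>d>0. \<forall>s. 0 < s \<and> s < d \<longrightarrow> \<bar>\<Delta> s u v - s\<^sup>2 * (H v \<bullet> u)\<bar> \<le> e * s\<^sup>2"
    if "e > 0" for e u v
  proof -
    define M where "M = (norm u + norm v + 1)"
    have M: "M > 0" "norm u \<le> M" "norm v \<le> M" "norm u + norm v \<le> M"
      using norm_ge_zero[of u] norm_ge_zero[of v] unfolding M_def by linarith+
    obtain d1 where d1: "d1 > 0" "ball z d1 \<subseteq> N"
      using assms(1,2) openE by blast
    \<comment> \<open>Chosen so that two remainders of size \<open>e' * (s * M)\<close>, multiplied
      by the bound \<open>M\<close> for \<open>norm u\<close>, add up to exactly
      \<open>e * s\<close>.\<close>
    define e' where "e' = e / (2 * M * M)"
    have e': "e' > 0" using that M by (simp add: e'_def)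
    obtain d2 where d2: "d2 > 0"
      "\<And>y. norm (y - z) < d2 \<Longrightarrow> norm (n y - n z - H (y - z)) \<le> e' * norm (y - z)"
      using n e' unfolding has_derivative_at_alt by blast
    define d where "d = min d1 d2 / M"
    have d: "d > 0" using d1 d2 M by (simp add: d_def)
    have "\<bar>\<Delta> s u v - s\<^sup>2 * (H v \<bullet> u)\<bar> \<le> e * s\<^sup>2" if s: "0 < s" "s < d" for s
    proof -
      have sM: "s * M < d1" "s * M < d2"
        using s M by (auto simp: d_def field_simps)
      have near: "norm (a *\<^sub>R u + b *\<^sub>R v) \<le> s * M" if "0 \<le> a" "a \<le> s" "0 \<le> b" "b \<le> s" for a b
      proof -
        have "norm (a *\<^sub>R u + b *\<^sub>R v) \<le> a * norm u + b * norm v"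
          using norm_triangle_ineq[of "a *\<^sub>R u" "b *\<^sub>R v"] that by simp
        also have "\<dots> \<le> s * norm u + s * norm v"
          using that by (intro add_mono mult_right_mono) auto
        also have "\<dots> \<le> s * M"
          using M s by (simp flip: distrib_left)
        finally show ?thesis .
      qed
      \<comment> \<open>The first difference in direction \<open>v\<close> as a function of the step
        along \<open>u\<close>; one application of the mean value theorem then leaves a difference
        of gradients. The term \<open>0 *\<^sub>R v\<close> gives both summands the same shape, so
        that one derivative rule serves both.\<close>
      define \<phi> where "\<phi> x = f (z + (x *\<^sub>R u + s *\<^sub>R v)) - f (z + (x *\<^sub>R u + 0 *\<^sub>R v))" for x
      define \<phi>' where "\<phi>' x = u \<bullet> n (z + (x *\<^sub>R u + s *\<^sub>R v)) - u \<bullet> n (z + (x *\<^sub>R u + 0 *\<^sub>R v))" for x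
      have der: "DERIV \<phi> x :> \<phi>' x" if x: "0 \<le> x" "x \<le> s" for x
      proof -
        have *: "((\<lambda>x. f (z + (x *\<^sub>R u + b *\<^sub>R v))) has_derivative
            (\<lambda>k. (k *\<^sub>R u) \<bullet> n (z + (x *\<^sub>R u + b *\<^sub>R v)))) (at x)"
          if b: "0 \<le> b" "b \<le> s" for b
        proof (rule has_derivative_compose[where g = f and f = "\<lambda>x. z + (x *\<^sub>R u + b *\<^sub>R v)"])
          show "((\<lambda>x. z + (x *\<^sub>R u + b *\<^sub>R v)) has_derivative (\<lambda>k. k *\<^sub>R u)) (at x)"
            by (auto intro!: derivative_eq_intros)
          have "z + (x *\<^sub>R u + b *\<^sub>R v) \<in> N"
            using near[OF x b] sM(1)
            by (intro subsetD[OF d1(2)], unfold mem_ball dist_commute[of z])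
               (simp only: dist_norm add_diff_cancel_left')
          then show "(f has_derivative (\<lambda>h. h \<bullet> n (z + (x *\<^sub>R u + b *\<^sub>R v))))
              (at (z + (x *\<^sub>R u + b *\<^sub>R v)))"
            using f by (simp add: gderiv_def)
        qed
        have "(\<phi> has_derivative (\<lambda>k. (k *\<^sub>R u) \<bullet> n (z + (x *\<^sub>R u + s *\<^sub>R v))
               - (k *\<^sub>R u) \<bullet> n (z + (x *\<^sub>R u + 0 *\<^sub>R v)))) (at x)"
          unfolding \<phi>_def using s by (intro has_derivative_diff *) auto
        then show ?thesis
          unfolding has_field_derivative_def \<phi>'_def
          by (rule has_derivative_eq_rhs) (auto simp: fun_eq_iff algebra_simps)
      qed
      obtain x where x: "0 < x" "x < s" "\<phi> s - \<phi> 0 = (s - 0) * \<phi>' x"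
        using MVT2[OF s(1), of \<phi> \<phi>'] der by blast
      have \<Delta>: "\<Delta> s u v = s * \<phi>' x"
        using x(3) by (simp add: \<Delta>_def \<phi>_def add.assoc)
      \<comment> \<open>The remainder of the first-order expansion of \<open>n\<close> at
        \<open>z\<close>. In \<open>\<phi>' x\<close> the contributions of
        \<open>x *\<^sub>R u\<close> cancel and only \<open>s * (H v \<bullet> u)\<close> and two
        remainders survive.\<close>
      define R where "R b = n (z + (x *\<^sub>R u + b *\<^sub>R v)) - n z - H (x *\<^sub>R u + b *\<^sub>R v)" for b
      have R: "norm (R b) \<le> e' * (s * M)" if "0 \<le> b" "b \<le> s" for b
      proof -
        have "norm (R b) \<le> e' * norm (x *\<^sub>R u + b *\<^sub>R v)"
          using d2(2)[of "z + (x *\<^sub>R u + b *\<^sub>R v)"] near[of x b] x that sM(2) by (simp add: R_def)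
        also have "\<dots> \<le> e' * (s * M)"
          using near[of x b] x that e' by (intro mult_left_mono) auto
        finally show ?thesis .
      qed
      have "\<phi>' x = s * (H v \<bullet> u) + u \<bullet> (R s - R 0)"
        using lin by (simp add: \<phi>'_def R_def linear_add linear_cmul algebra_simps inner_commute)
      then have "\<bar>\<phi>' x - s * (H v \<bullet> u)\<bar> = \<bar>u \<bullet> (R s - R 0)\<bar>" by simp
      also have "\<dots> \<le> norm u * norm (R s - R 0)" by (rule Cauchy_Schwarz_ineq2)
      also have "\<dots> \<le> M * (e' * (s * M) + e' * (s * M))"
      proof (rule mult_mono)
        show "norm (R s - R 0) \<le> e' * (s * M) + e' * (s * M)"
          using R[of s] R[of 0] s norm_triangle_ineq4[of "R s" "R 0"] by linarith
      qed (use M in auto)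
      also have "\<dots> = e * s"
        using M by (simp add: e'_def field_simps)
      finally have "s * \<bar>\<phi>' x - s * (H v \<bullet> u)\<bar> \<le> s * (e * s)"
        using s by (intro mult_left_mono) auto
      moreover have "\<Delta> s u v - s\<^sup>2 * (H v \<bullet> u) = s * (\<phi>' x - s * (H v \<bullet> u))"
        by (simp add: \<Delta> power2_eq_square right_diff_distrib mult.assoc)
      then have "\<bar>\<Delta> s u v - s\<^sup>2 * (H v \<bullet> u)\<bar> = s * \<bar>\<phi>' x - s * (H v \<bullet> u)\<bar>"
        using s by (simp add: abs_mult)
      ultimately show ?thesis
        by (simp add: power2_eq_square mult.left_commute mult.assoc)
    qed
    then show ?thesis using d by blast
  qed
  have sym: "\<Delta> s u v = \<Delta> s v u" for s
    by (simp add: \<Delta>_def algebra_simps)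
  have "\<bar>H u \<bullet> v - H v \<bullet> u\<bar> \<le> e" if "e > 0" for e
  proof -
    have "e / 2 > 0" using that by simp
    then obtain d1 d2 where d: "d1 > 0" "d2 > 0"
      "\<And>s. 0 < s \<Longrightarrow> s < d1 \<Longrightarrow> \<bar>\<Delta> s u v - s\<^sup>2 * (H v \<bullet> u)\<bar> \<le> e / 2 * s\<^sup>2"
      "\<And>s. 0 < s \<Longrightarrow> s < d2 \<Longrightarrow> \<bar>\<Delta> s v u - s\<^sup>2 * (H u \<bullet> v)\<bar> \<le> e / 2 * s\<^sup>2"
      using est by metis
    define s where "s = min d1 d2 / 2"
    have s: "0 < s" "s < d1" "s < d2" using d by (auto simp: s_def)
    have "s\<^sup>2 * \<bar>H u \<bullet> v - H v \<bullet> u\<bar> = \<bar>s\<^sup>2 * (H u \<bullet> v) - s\<^sup>2 * (H v \<bullet> u)\<bar>"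
      by (simp add: abs_mult flip: right_diff_distrib)
    also have "\<dots> \<le> e / 2 * s\<^sup>2 + e / 2 * s\<^sup>2"
      using d(3)[OF s(1,2)] d(4)[OF s(1,3)] sym[of s] by linarith
    finally have "s\<^sup>2 * \<bar>H u \<bullet> v - H v \<bullet> u\<bar> \<le> s\<^sup>2 * e" by (simp add: mult.commute)
    then show ?thesis using s(1) by simp
  qed
  then have "\<bar>H u \<bullet> v - H v \<bullet> u\<bar> \<le> 0"
    by (rule field_le_epsilon[of _ 0, simplified])
  then show ?thesis by simp
qed

text \<open>Restrict \<open>f\<close> to the line through \<open>z\<close> in direction
  \<open>h\<close>. The first derivative vanishes at 0; were its own derivative there negative, it
  would be negative just to the right of 0, and the mean value theorem would produce values below
  the minimum.\<close>

lemma second_derivative_nonneg_at_minimum: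
  fixes f :: "'a::real_inner \<Rightarrow> real"
  assumes "open N" "z \<in> N" and f: "\<And>w. w \<in> N \<Longrightarrow> GDERIV f w :> n w"
    and n: "(n has_derivative H) (at z)"
    and min: "\<And>w. w \<in> N \<Longrightarrow> f z \<le> f w"
  shows "0 \<le> H h \<bullet> h"
proof (rule ccontr)
  assume neg: "\<not> 0 \<le> H h \<bullet> h"
  define N' where "N' = {s::real. z + s *\<^sub>R h \<in> N}"
  have "open N'"
    unfolding N'_def
    by (rule open_vimage[OF assms(1), of "\<lambda>s. z + s *\<^sub>R h", unfolded vimage_def])
       (intro continuous_intros)
  have "0 \<in> N'" using assms(2) by (simp add: N'_def)
  obtain d0 where d0: "d0 > 0" "ball 0 d0 \<subseteq> N'"
    using \<open>open N'\<close> \<open>0 \<in> N'\<close> openE by blast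
  have line: "((\<lambda>s. z + s *\<^sub>R h) has_derivative (\<lambda>k. k *\<^sub>R h)) (at s)" for s
    by (auto intro!: derivative_eq_intros)
  define \<phi> where "\<phi> s = f (z + s *\<^sub>R h)" for s
  define \<phi>' where "\<phi>' s = h \<bullet> n (z + s *\<^sub>R h)" for s
  have der: "DERIV \<phi> s :> \<phi>' s" if "\<bar>s\<bar> < d0" for s
  proof -
    have "z + s *\<^sub>R h \<in> N"
      using d0(2) that by (auto simp: N'_def dist_norm)
    then have "(\<phi> has_derivative (\<lambda>k. (k *\<^sub>R h) \<bullet> n (z + s *\<^sub>R h))) (at s)"
      unfolding \<phi>_def using f[unfolded gderiv_def]
      by (intro has_derivative_compose[OF line, where g = f])
    then show ?thesis
      unfolding has_field_derivative_def \<phi>'_def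
      by (rule has_derivative_eq_rhs) (auto simp: fun_eq_iff mult.commute)
  qed
  have "(\<phi>' has_derivative (\<lambda>k. h \<bullet> H (k *\<^sub>R h))) (at 0)"
    unfolding \<phi>'_def using n
    by (intro has_derivative_inner_right has_derivative_compose[OF line, where g = n]) auto
  then have der2: "DERIV \<phi>' 0 :> H h \<bullet> h"
    unfolding has_field_derivative_def
    by (rule has_derivative_eq_rhs)
       (use has_derivative_linear[OF n] in \<open>auto simp: fun_eq_iff linear_cmul inner_commute mult.commute\<close>)
  have "\<phi>' 0 = 0"
  proof (rule DERIV_local_min[OF _ d0(1)])
    show "DERIV \<phi> 0 :> \<phi>' 0" using der d0 by simp
    show "\<forall>y. \<bar>0 - y\<bar> < d0 \<longrightarrow> \<phi> 0 \<le> \<phi> y"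
      using min d0(2) by (auto simp: \<phi>_def N'_def dist_norm)
  qed
  obtain d where d: "d > 0" "\<And>s. 0 < s \<Longrightarrow> s < d \<Longrightarrow> \<phi>' s < 0"
    using DERIV_neg_dec_right[OF der2] neg \<open>\<phi>' 0 = 0\<close> by auto
  define s where "s = min d d0 / 2"
  have s: "0 < s" "s < d" "s < d0" using d d0 by (auto simp: s_def)
  obtain x where x: "0 < x" "x < s" "\<phi> s - \<phi> 0 = (s - 0) * \<phi>' x"
    using MVT2[OF s(1), of \<phi> \<phi>'] der s by (metis abs_of_nonneg order_le_less_trans)
  have "\<phi> s < \<phi> 0"
    using x d(2)[of x] s mult_pos_neg[of s "\<phi>' x"] by simp
  moreover have "\<phi> 0 \<le> \<phi> s"
    using min subsetD[OF d0(2), of s] s by (simp add: \<phi>_def N'_def)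
  ultimately show False by simp
qed

section \<open>Signed distance and nearest boundary points\<close>

lemma signed_distance_frontier [simp]: "p \<in> frontier \<Omega> \<Longrightarrow> signed_distance \<Omega> p = 0"
  by (simp add: signed_distance_def)

lemma abs_signed_distance: "\<bar>signed_distance \<Omega> z\<bar> = infdist z (frontier \<Omega>)"
  by (simp add: signed_distance_def infdist_nonneg)

lemma signed_distance_neg:
  fixes \<Omega> :: "'a::metric_space set"
  assumes "open \<Omega>" "frontier \<Omega> \<noteq> {}" "z \<in> \<Omega>"
  shows "signed_distance \<Omega> z < 0"
proof -
  have "z \<notin> frontier \<Omega>"
    using assms by (simp add: frontier_def interior_open)
  then have "infdist z (frontier \<Omega>) \<noteq> 0"
    using in_closed_iff_infdist_zero[OF frontier_closed assms(2)] by blast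
  then show ?thesis
    using assms(3) infdist_nonneg[of z "frontier \<Omega>"] by (simp add: signed_distance_def)
qed

text \<open>The segment from \<open>x\<close> to \<open>y\<close> is connected and meets both sides,
  so it contains a frontier point, which splits its length.\<close>

lemma infdist_add_le_dist_across:
  fixes \<Omega> :: "'a::euclidean_space set"
  assumes "x \<in> \<Omega>" "y \<notin> \<Omega>"
  shows "infdist x (frontier \<Omega>) + infdist y (frontier \<Omega>) \<le> dist x y"
proof -
  have "closed_segment x y \<inter> frontier \<Omega> \<noteq> {}"
    by (rule connected_Int_frontier) (use assms in auto)
  then obtain q where q: "q \<in> closed_segment x y" "q \<in> frontier \<Omega>" by blast
  have "dist x y = dist x q + dist q y"
    using q(1) unfolding between_mem_segment[symmetric] between by blast
  then show ?thesis
    using infdist_le[OF q(2), of x] infdist_le[OF q(2), of y] by (simp add: dist_commute)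
qed

text \<open>On one side of the frontier this is the Lipschitz property of \<open>infdist\<close>;
  for points on opposite sides it comes from crossing the frontier.\<close>

lemma signed_distance_le:
  fixes \<Omega> :: "'a::euclidean_space set"
  shows "signed_distance \<Omega> x \<le> signed_distance \<Omega> y + dist x y"
proof (cases "(x \<in> \<Omega>) = (y \<in> \<Omega>)")
  case True
  then show ?thesis
    using infdist_triangle[of x "frontier \<Omega>" y] infdist_triangle[of y "frontier \<Omega>" x]
    by (auto simp: signed_distance_def dist_commute)
next
  case False
  then show ?thesis
    using infdist_add_le_dist_across[of x \<Omega> y] infdist_add_le_dist_across[of y \<Omega> x]
      infdist_nonneg[of x "frontier \<Omega>"] infdist_nonneg[of y "frontier \<Omega>"]
      zero_le_dist[of x y]
    by (auto simp: signed_distance_def dist_commute)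
qed

lemma nearest_frontier_point:
  fixes \<Omega> :: "'a::heine_borel set"
  assumes "frontier \<Omega> \<noteq> {}"
  obtains p where "p \<in> frontier \<Omega>" "\<bar>signed_distance \<Omega> z\<bar> = dist z p"
proof -
  obtain p where "p \<in> frontier \<Omega>" "infdist z (frontier \<Omega>) = dist z p"
    using infdist_attains_inf[OF frontier_closed assms] by blast
  then show ?thesis
    by (simp add: abs_signed_distance that)
qed

text \<open>A frontier point lies outside the open set, so \<open>r p\<close> is not negative. If it
  were positive, \<open>r\<close> would be positive near \<open>p\<close>, although points of
  \<open>\<Omega>\<close> accumulate there.\<close>

lemma defining_function_zero_on_frontier:
  assumes "open \<Omega>" "open U" "continuous_on U r" "U \<inter> \<Omega> = {z \<in> U. r z < (0::real)}"
    and "p \<in> U" "p \<in> frontier \<Omega>"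
  shows "r p = 0"
proof (rule antisym)
  have "p \<notin> \<Omega>"
    using assms by (simp add: frontier_def interior_open)
  then show "0 \<le> r p" using assms by force
  show "r p \<le> 0"
  proof (rule ccontr)
    assume "\<not> r p \<le> 0"
    define T where "T = U \<inter> r -` {0<..}"
    have "open T"
      unfolding T_def using assms(2,3) by (intro continuous_open_preimage) auto
    moreover have "p \<in> T" using \<open>\<not> r p \<le> 0\<close> assms(5) by (simp add: T_def)
    moreover have "p \<in> closure \<Omega>" using assms(6) by (simp add: frontier_def)
    ultimately obtain x where "x \<in> T" "x \<in> \<Omega>"
      using open_Int_closure_eq_empty by blast
    then have "x \<in> U \<inter> \<Omega>" "r x > 0" by (auto simp: T_def)
    then show False unfolding assms(4) by simp
  qed
qed

text \<open>The vector \<open>W\<close> measures the failure of the conclusion. By Cauchy-Schwarz it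
  lies in the closed half space of \<open>w\<close>, so the hypothesis applies to it after a small
  push along \<open>w\<close>.\<close>

lemma antiparallel_of_half_space:
  fixes g w :: "'a::real_inner"
  assumes "w \<noteq> 0" and h: "\<And>v. v \<bullet> w > 0 \<Longrightarrow> v \<bullet> g \<le> 0"
  shows "norm w *\<^sub>R g = - (norm g *\<^sub>R w)"
proof -
  define W where "W = norm g *\<^sub>R w + norm w *\<^sub>R g"
  have ww: "w \<bullet> w = norm w * norm w" and gg: "g \<bullet> g = norm g * norm g"
    by (simp_all add: dot_square_norm power2_eq_square)
  have Ww: "W \<bullet> w = norm w * (norm w * norm g + w \<bullet> g)"
    unfolding W_def inner_add_left inner_scaleR_left ww inner_commute[of g w]
    by (simp only: distrib_left ac_simps)
  have Wg: "W \<bullet> g = norm g * (norm w * norm g + w \<bullet> g)"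
    unfolding W_def inner_add_left inner_scaleR_left gg
    by (simp only: distrib_left ac_simps)
  have "0 \<le> norm w * norm g + w \<bullet> g"
    using Cauchy_Schwarz_ineq2[of w g] by linarith
  then have pos: "0 \<le> W \<bullet> w"
    unfolding Ww by (intro mult_nonneg_nonneg) auto
  \<comment> \<open>The perturbation \<open>W + s w\<close> lies in the open half space;
    \<open>s\<close> is so small that the error \<open>s * \<bar>w \<bullet> g\<bar>\<close> stays
    below \<open>e\<close>.\<close>
  have le: "W \<bullet> g \<le> e" if "e > 0" for e
  proof -
    define s where "s = e / (1 + \<bar>w \<bullet> g\<bar>)"
    have s: "s > 0" using that by (simp add: s_def add_pos_nonneg)
    have "0 < s * (w \<bullet> w)"
      using s assms(1) by simp
    then have "(W + s *\<^sub>R w) \<bullet> w > 0"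
      unfolding inner_add_left inner_scaleR_left using pos by linarith
    then have "(W + s *\<^sub>R w) \<bullet> g \<le> 0" by (rule h)
    then have "W \<bullet> g \<le> s * (- (w \<bullet> g))"
      by (simp add: inner_add_left)
    also have "\<dots> \<le> s * \<bar>w \<bullet> g\<bar>"
      using s by (intro mult_left_mono) auto
    also have "\<dots> \<le> e"
      using that by (simp add: s_def divide_simps)
    finally show ?thesis .
  qed
  have "W \<bullet> g \<le> 0"
    by (rule field_le_epsilon) (simp add: le)
  \<comment> \<open>Both summands of \<open>W \<bullet> W\<close> equal this nonpositive number,
    which forces \<open>W = 0\<close>.\<close>
  then have "norm w * (W \<bullet> g) \<le> 0"
    by (simp add: mult_nonneg_nonpos)
  moreover have "norm g * (W \<bullet> w) = norm w * (W \<bullet> g)"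
    unfolding Ww Wg by (simp only: mult.left_commute)
  moreover have "W \<bullet> W = norm g * (W \<bullet> w) + norm w * (W \<bullet> g)"
    by (subst (2) W_def) (simp only: inner_add_right inner_scaleR_right)
  ultimately have "W \<bullet> W \<le> 0" by linarith
  then have "W = 0"
    by (metis inner_eq_zero_iff inner_ge_zero order_antisym)
  then show ?thesis
    unfolding W_def by (simp only: eq_neg_iff_add_eq_0 add.commute)
qed

lemma GDERIV_along_line:
  assumes "GDERIV r p :> g"
  shows "((\<lambda>s. r (p + s *\<^sub>R v)) has_real_derivative v \<bullet> g) (at 0)"
proof -
  have "((\<lambda>s. p + s *\<^sub>R v) has_derivative (\<lambda>k. k *\<^sub>R v)) (at 0)"
    by (auto intro!: derivative_eq_intros)
  then have "((\<lambda>s. r (p + s *\<^sub>R v)) has_derivative (\<lambda>k. (k *\<^sub>R v) \<bullet> g)) (at 0)"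
    by (rule has_derivative_compose[where g = r]) (use assms in \<open>simp add: gderiv_def\<close>)
  then show ?thesis
    unfolding has_field_derivative_def
    by (rule has_derivative_eq_rhs) (auto simp: fun_eq_iff mult.commute)
qed

text \<open>With \<open>w = z - p\<close>, the squared distance to \<open>z\<close> changes by
  \<open>s (s (v \<bullet> v) - 2 (v \<bullet> w))\<close>, which is negative for small positive
  \<open>s\<close>.\<close>

lemma eventually_in_ball_from_boundary_point:
  fixes v :: "'a::real_inner"
  assumes "v \<bullet> (z - p) > 0"
  shows "\<forall>\<^sub>F s in at_right 0. dist z (p + s *\<^sub>R v) < dist z p"
proof -
  define w where "w = z - p"
  have "v \<noteq> 0" using assms by auto
  then have vv: "v \<bullet> v > 0" by simp
  have "\<forall>\<^sub>F s in at_right 0. s \<in> {0<..<2 * (v \<bullet> w) / (v \<bullet> v)}"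
    by (rule eventually_at_right_real) (use assms vv in \<open>simp add: w_def\<close>)
  then show ?thesis
  proof eventually_elim
    case (elim s)
    then have s: "0 < s" "s * (v \<bullet> v) < 2 * (v \<bullet> w)"
      using vv by (auto simp: field_simps)
    have "(w - s *\<^sub>R v) \<bullet> (w - s *\<^sub>R v) = w \<bullet> w + s * (s * (v \<bullet> v) - 2 * (v \<bullet> w))"
      by (simp add: inner_diff_left inner_diff_right inner_commute algebra_simps)
    also have "\<dots> < w \<bullet> w"
      using mult_pos_neg[of s "s * (v \<bullet> v) - 2 * (v \<bullet> w)"] s by simp
    finally have "norm (w - s *\<^sub>R v) < norm w"
      by (simp add: norm_eq_sqrt_inner)
    then show ?case
      by (simp add: w_def dist_norm algebra_simps)
  qed
qed

text \<open>The open ball around \<open>z\<close> through its nearest frontier point \<open>p\<close> lies on one side of the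
  frontier, so that \<open>r\<close> has a fixed sign on it; this forces \<open>z - p\<close> to be normal at \<open>p\<close>.\<close>

lemma nearest_point_normal:
  fixes \<Omega> :: "'a::euclidean_space set" and r :: "'a \<Rightarrow> real"
  assumes "open \<Omega>" "open U" "continuous_on U r" and \<Omega>: "U \<inter> \<Omega> = {z \<in> U. r z < 0}"
    and p: "p \<in> U" "p \<in> frontier \<Omega>" and near: "\<bar>signed_distance \<Omega> z\<bar> = dist z p"
    and g: "GDERIV r p :> g" "g \<noteq> 0"
  shows "z = p + signed_distance \<Omega> z *\<^sub>R ((1 / norm g) *\<^sub>R g)"
proof (cases "z = p")
  case True
  then show ?thesis using p by simp
next
  case False
  define w where "w = z - p"
  have w: "w \<noteq> 0" using False by (simp add: w_def)
  have rp: "r p = 0"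
    by (rule defining_function_zero_on_frontier[OF assms(1-3) \<Omega> p])
  have mem: "x \<in> \<Omega> \<longleftrightarrow> r x < 0" if "x \<in> U" for x
    using that eqset_imp_iff[OF \<Omega>, of x] by simp
  have disj: "ball z (dist z p) \<inter> frontier \<Omega> = {}"
  proof (rule ccontr)
    assume "ball z (dist z p) \<inter> frontier \<Omega> \<noteq> {}"
    then obtain q where q: "q \<in> frontier \<Omega>" "dist z q < dist z p" by auto
    then show False
      using infdist_le[OF q(1), of z] near by (simp add: abs_signed_distance)
  qed
  have zb: "z \<in> ball z (dist z p)" using False by simp
  have in_ball: "\<forall>\<^sub>F s in at_right 0. p + s *\<^sub>R v \<in> ball z (dist z p) \<inter> U" if "v \<bullet> w > 0" for v
  proof -
    have "((\<lambda>s. p + s *\<^sub>R v) \<longlongrightarrow> p + 0 *\<^sub>R v) (at_right 0)"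
      by (intro tendsto_intros)
    then have "\<forall>\<^sub>F s in at_right 0. p + s *\<^sub>R v \<in> U"
      using topological_tendstoD[OF _ assms(2)] p(1) by simp
    then show ?thesis
      using eventually_in_ball_from_boundary_point[of v z p] that
      by (auto elim: eventually_elim2 simp: w_def)
  qed
  \<comment> \<open>Directions with \<open>v \<bullet> w > 0\<close> enter the ball at once. A
    function that vanishes at \<open>p\<close> and is nonpositive on the ball cannot increase along
    them.\<close>
  have sgn_der: "v \<bullet> g' \<le> 0"
    if f: "((\<lambda>s. f (p + s *\<^sub>R v)) has_real_derivative v \<bullet> g') (at 0)" "f p = 0"
      and le: "\<And>x. x \<in> ball z (dist z p) \<inter> U \<Longrightarrow> f x \<le> 0" and v: "v \<bullet> w > 0" for f v g'
  proof (rule ccontr)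
    assume "\<not> v \<bullet> g' \<le> 0"
    then obtain d where d: "d > 0" "\<And>h. 0 < h \<Longrightarrow> h < d \<Longrightarrow> f (p + h *\<^sub>R v) > 0"
      using DERIV_pos_inc_right[OF f(1)] f(2) by auto
    have "\<forall>\<^sub>F s in at_right 0. s \<in> {0<..<d}"
      by (rule eventually_at_right_real) (rule d(1))
    then have "\<forall>\<^sub>F s in at_right (0::real). False"
      using in_ball[OF v] by eventually_elim (use le d(2) in force)
    then show False by simp
  qed
  have "norm g *\<^sub>R w = (signed_distance \<Omega> z) *\<^sub>R g"
  proof (cases "z \<in> \<Omega>")
    case True
    have "ball z (dist z p) \<subseteq> \<Omega>"
      using connected_Int_frontier[of "ball z (dist z p)" \<Omega>] zb True disj by blast
    then have "r x \<le> 0" if "x \<in> ball z (dist z p) \<inter> U" for x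
      using that mem[of x] by auto
    then have "norm w *\<^sub>R g = - (norm g *\<^sub>R w)"
      using w rp by (intro antiparallel_of_half_space sgn_der[of r])
                    (auto intro: GDERIV_along_line g)
    moreover have "signed_distance \<Omega> z = - norm w"
      using near True by (simp add: w_def dist_norm signed_distance_def infdist_nonneg)
    ultimately show ?thesis by simp
  next
    case False
    have "ball z (dist z p) \<inter> \<Omega> = {}"
      using connected_Int_frontier[of "ball z (dist z p)" \<Omega>] zb False disj by blast
    \<comment> \<open>For \<open>z\<close> outside \<open>\<Omega>\<close> the ball avoids
      \<open>\<Omega>\<close>, and the same argument is run with \<open>- r\<close>; the opposite
      sign of the normal matches that of the signed distance.\<close>
    then have "- r x \<le> 0" if "x \<in> ball z (dist z p) \<inter> U" for x
      using that mem[of x] by auto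
    then have "norm w *\<^sub>R (- g) = - (norm (- g) *\<^sub>R w)"
      using w rp by (intro antiparallel_of_half_space sgn_der[of "\<lambda>x. - r x"])
                    (auto intro!: DERIV_minus GDERIV_along_line g)
    moreover have "signed_distance \<Omega> z = norm w"
      using near False by (simp add: w_def dist_norm signed_distance_def infdist_nonneg)
    ultimately show ?thesis by simp
  qed
  then have "(1 / norm g) *\<^sub>R (norm g *\<^sub>R w) = (1 / norm g) *\<^sub>R (signed_distance \<Omega> z *\<^sub>R g)"
    by simp
  then have "w = signed_distance \<Omega> z *\<^sub>R ((1 / norm g) *\<^sub>R g)"
    using g(2) by (simp add: mult.commute)
  then show ?thesis by (simp add: w_def algebra_simps)
qed

section \<open>Regularity of the signed distance\<close>

text \<open>The orthogonality reflects that \<open>\<nu>\<close> has constant length. It later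
  removes the term with \<open>\<nu>'\<close> when the derivative of the signed distance is
  computed.\<close>

lemma smooth_unit_normal:
  fixes r :: "'a::euclidean_space \<Rightarrow> real"
  assumes "open U" "smooth_on U r" "\<And>x. x \<in> U \<Longrightarrow> gradient r x \<noteq> 0"
  defines "\<nu> \<equiv> \<lambda>x. (1 / norm (gradient r x)) *\<^sub>R gradient r x"
  obtains \<nu>' where "\<And>x. x \<in> U \<Longrightarrow> (\<nu> has_derivative blinfun_apply (\<nu>' x)) (at x)"
    and "continuous_on U \<nu>'"
    and "\<And>x h. x \<in> U \<Longrightarrow> \<nu> x \<bullet> blinfun_apply (\<nu>' x) h = 0"
proof -
  obtain g' where g': "\<And>x. x \<in> U \<Longrightarrow> (gradient r has_derivative blinfun_apply (g' x)) (at x)"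
    "continuous_on U g'"
    using smooth_gradient[OF assms(1,2)] by metis
  define D where "D x h = (1 / norm (gradient r x)) *\<^sub>R g' x h
    - ((gradient r x \<bullet> g' x h) / norm (gradient r x) ^ 3) *\<^sub>R gradient r x" for x h
  have der: "(\<nu> has_derivative D x) (at x)" if "x \<in> U" for x
    unfolding \<nu>_def D_def by (rule has_derivative_normalized[OF g'(1)[OF that] assms(3)[OF that]])
  have D: "blinfun_apply (Blinfun (D x)) = D x" if "x \<in> U" for x
    using der[OF that] by (intro bounded_linear_Blinfun_apply has_derivative_bounded_linear)
  have cont: "continuous_on U (gradient r)"
    using g'(1) by (meson assms(1) continuous_on_eq_continuous_at has_derivative_continuous)
  show ?thesis
  proof
    show "(\<nu> has_derivative blinfun_apply (Blinfun (D x))) (at x)" if "x \<in> U" for x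
      using der D that by simp
    show "continuous_on U (\<lambda>x. Blinfun (D x))"
    proof (rule continuous_on_blinfun_componentwise)
      fix i :: 'a
      have "continuous_on U (\<lambda>x. D x i)"
        unfolding D_def using assms(3) by (intro continuous_intros cont g'(2)) auto
      then show "continuous_on U (\<lambda>x. blinfun_apply (Blinfun (D x)) i)"
        using D by (simp cong: continuous_on_cong)
    qed
    show "\<nu> x \<bullet> blinfun_apply (Blinfun (D x)) h = 0" if "x \<in> U" for x h
      using assms(3)[OF that]
      by (simp add: D[OF that] D_def \<nu>_def inner_diff_right dot_square_norm power2_eq_square
          power3_eq_cube divide_simps)
  qed
qed

text \<open>The map is \<open>(x, s) \<mapsto> (x + s \<nu>(x), r(x))\<close>; the preimage of \<open>(z, 0)\<close> consists of the nearest
  boundary point of \<open>z\<close> and the signed distance of \<open>z\<close>.\<close>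

lemma normal_coordinates:
  fixes r :: "'a::euclidean_space \<Rightarrow> real"
  assumes "open U" "p \<in> U"
    and r: "\<And>x. x \<in> U \<Longrightarrow> GDERIV r x :> gradient r x"
    and g: "continuous_on U (gradient r)" "gradient r p \<noteq> 0"
    and \<nu>: "\<And>x. x \<in> U \<Longrightarrow> (\<nu> has_derivative blinfun_apply (\<nu>' x)) (at x)"
      "continuous_on U \<nu>'"
    and \<nu>p: "\<nu> p \<bullet> gradient r p \<noteq> 0"
  obtains W V \<Gamma> \<Gamma>' where "open W" "W \<subseteq> U \<times> UNIV" "(p, 0) \<in> W"
    and "open V" "(p, r p) \<in> V"
    and "\<And>x s. (x, s) \<in> W \<Longrightarrow> \<Gamma> (x + s *\<^sub>R \<nu> x, r x) = (x, s)"
    and "\<And>y. y \<in> V \<Longrightarrow> (\<Gamma> has_derivative \<Gamma>' y) (at y)"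
proof -
  define F where "F = (\<lambda>(x, s). (x + s *\<^sub>R \<nu> x, r x))"
  define D where "D y k = (fst k + (snd y *\<^sub>R \<nu>' (fst y) (fst k) + snd k *\<^sub>R \<nu> (fst y)),
      fst k \<bullet> gradient r (fst y))" for y k
  have der: "(F has_derivative D y) (at y)" if "y \<in> U \<times> UNIV" for y
  proof -
    have y: "fst y \<in> U" using that by auto
    have 1: "((\<lambda>y. r (fst y)) has_derivative (\<lambda>k. fst k \<bullet> gradient r (fst y))) (at y)"
      by (rule has_derivative_compose[where g = r and f = fst])
         (use r[OF y] in \<open>auto simp: gderiv_def intro!: derivative_intros\<close>)
    have 2: "((\<lambda>y. \<nu> (fst y)) has_derivative (\<lambda>k. \<nu>' (fst y) (fst k))) (at y)"
      by (rule has_derivative_compose[where g = \<nu> and f = fst, OF _ \<nu>(1)[OF y]])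
         (auto intro!: derivative_intros)
    show ?thesis
      unfolding F_def D_def case_prod_unfold
      by (intro has_derivative_Pair has_derivative_add has_derivative_scaleR 1 2 derivative_intros)
  qed
  have D: "blinfun_apply (Blinfun (D y)) = D y" if "y \<in> U \<times> UNIV" for y
    using der[OF that] by (intro bounded_linear_Blinfun_apply has_derivative_bounded_linear)
  have cont\<nu>: "continuous_on U \<nu>"
    using \<nu>(1) by (meson assms(1) continuous_on_eq_continuous_at has_derivative_continuous)
  have contD: "continuous_on (U \<times> UNIV) (\<lambda>y. Blinfun (D y))"
  proof (rule continuous_on_blinfun_componentwise)
    fix i :: "'a \<times> real"
    have *: "continuous_on (U \<times> UNIV) (\<lambda>y. f (fst y))" if "continuous_on U f"
      for f :: "'a \<Rightarrow> 'c::topological_space"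
      by (rule continuous_on_compose2[OF that]) (auto intro!: continuous_intros)
    have "continuous_on (U \<times> UNIV) (\<lambda>y. D y i)"
      unfolding D_def by (intro continuous_intros * cont\<nu> \<nu>(2) g(1))
    then show "continuous_on (U \<times> UNIV) (\<lambda>y. blinfun_apply (Blinfun (D y)) i)"
      using D by (simp cong: continuous_on_cong)
  qed
  \<comment> \<open>The inverse of \<open>D (p, 0)\<close>: pairing the equation
    \<open>h + \<sigma> \<nu> p = fst k\<close> with \<open>gradient r p\<close> and using
    \<open>h \<bullet> gradient r p = snd k\<close> determines \<open>\<sigma>\<close>, and then
    \<open>h\<close>.\<close>
  define E where "E k = (let \<sigma> = (fst k \<bullet> gradient r p - snd k) / (\<nu> p \<bullet> gradient r p)
      in (fst k - \<sigma> *\<^sub>R \<nu> p, \<sigma>))" for k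
  have "bounded_linear E"
    unfolding E_def Let_def
    by (intro bounded_linear_Pair bounded_linear_sub bounded_linear_fst bounded_linear_snd
        bounded_linear_compose[OF bounded_linear_scaleR_left]
        bounded_linear_compose[OF bounded_linear_divide]
        bounded_linear_compose[OF bounded_linear_inner_left])
  then have E: "blinfun_apply (Blinfun E) = E"
    by (rule bounded_linear_Blinfun_apply)
  have p0: "(p, 0) \<in> U \<times> UNIV" using assms(2) by simp
  have inv: "Blinfun E o\<^sub>L Blinfun (D (p, 0)) = id_blinfun"
  proof (rule blinfun_eqI)
    fix k :: "'a \<times> real"
    show "(Blinfun E o\<^sub>L Blinfun (D (p, 0))) k = id_blinfun k"
      using \<nu>p by (cases k) (simp add: E D[OF p0] E_def D_def Let_def inner_add_left)
  qed
  have open_U: "open (U \<times> (UNIV :: real set))" using assms(1) by (simp add: open_Times)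
  have der': "(F has_derivative blinfun_apply (Blinfun (D y))) (at y)" if "y \<in> U \<times> UNIV" for y
    using der D that by simp
  obtain W V \<Gamma> \<Gamma>' where W: "open W" "W \<subseteq> U \<times> UNIV" "(p, 0) \<in> W" "open V" "F (p, 0) \<in> V"
    and hom: "homeomorphism W V F \<Gamma>"
    and d: "\<And>y. y \<in> V \<Longrightarrow> (\<Gamma> has_derivative \<Gamma>' y) (at y)"
    by (rule inverse_function_theorem[OF open_U der' contD p0 inv]) (assumption | rule that)+
  show ?thesis
  proof (rule that[OF W(1-4) _ _ d])
    show "(p, r p) \<in> V" using W(5) by (simp add: F_def)
    show "\<Gamma> (x + s *\<^sub>R \<nu> x, r x) = (x, s)" if "(x, s) \<in> W" for x s
      using homeomorphism_apply1[OF hom that] by (simp add: F_def)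
  qed
qed

text \<open>The inverse function theorem makes the projection to the boundary and the signed
  distance differentiable once. The gradient of the latter turns out to be the unit normal at the
  projection, a composition of differentiable maps, which gives the second derivative.\<close>

lemma signed_distance_regular_near_frontier:
  fixes \<Omega> :: "'a::euclidean_space set"
  assumes \<Omega>: "open \<Omega>" and r: "local_defining_function \<Omega> p U r" and p: "p \<in> frontier \<Omega>"
  obtains N n H B where "open N" "p \<in> N" "N \<subseteq> U"
    and "\<And>z. z \<in> N \<Longrightarrow> GDERIV (signed_distance \<Omega>) z :> n z"
    and "\<And>z. z \<in> N \<Longrightarrow> (n has_derivative H z) (at z)"
    and "\<And>z. z \<in> N \<Longrightarrow> norm (n z) = 1"
    and "\<And>q. q \<in> N \<inter> frontier \<Omega> \<Longrightarrow> gradient r q = norm (gradient r q) *\<^sub>R n q"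
    and "\<And>q h. q \<in> N \<inter> frontier \<Omega> \<Longrightarrow> \<bar>H q h \<bullet> h\<bar> \<le> B * (norm h)\<^sup>2"
proof -
  define \<delta> where "\<delta> = signed_distance \<Omega>"
  have U: "open U" "p \<in> U" "smooth_on U r" "U \<inter> \<Omega> = {z \<in> U. r z < 0}"
    and gn0: "\<And>z. z \<in> U \<Longrightarrow> gradient r z \<noteq> 0"
    using r by (auto simp: local_defining_function_def)
  obtain g' where gr: "\<And>x. x \<in> U \<Longrightarrow> GDERIV r x :> gradient r x"
    and g': "\<And>x. x \<in> U \<Longrightarrow> (gradient r has_derivative blinfun_apply (g' x)) (at x)"
    using smooth_gradient[OF U(1,3)] by metis
  have contg: "continuous_on U (gradient r)"
    using g' by (meson U(1) continuous_on_eq_continuous_at has_derivative_continuous)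
  have contr: "continuous_on U r"
    using gr U(1) by (meson continuous_on_eq_continuous_at has_derivative_continuous gderiv_def)
  define \<nu> where "\<nu> x = (1 / norm (gradient r x)) *\<^sub>R gradient r x" for x
  have \<nu>1: "norm (\<nu> x) = 1" if "x \<in> U" for x
    using gn0[OF that] by (simp add: \<nu>_def)
  have \<nu>g: "gradient r x = norm (gradient r x) *\<^sub>R \<nu> x" if "x \<in> U" for x
    using gn0[OF that] by (simp add: \<nu>_def)
  obtain \<nu>' where \<nu>': "\<And>x. x \<in> U \<Longrightarrow> (\<nu> has_derivative blinfun_apply (\<nu>' x)) (at x)"
    and cont\<nu>': "continuous_on U \<nu>'"
    and orth: "\<And>x h. x \<in> U \<Longrightarrow> \<nu> x \<bullet> blinfun_apply (\<nu>' x) h = 0"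
    by (rule smooth_unit_normal[OF U(1,3) gn0, folded \<nu>_def]) (assumption | rule that)+
  have \<nu>p: "\<nu> p \<bullet> gradient r p \<noteq> 0"
    using gn0[OF U(2)] by (simp add: \<nu>_def)
  obtain W V \<Gamma> \<Gamma>' where W: "open W" "W \<subseteq> U \<times> UNIV" "(p, 0) \<in> W"
    and V: "open V" "(p, r p) \<in> V"
    and \<Gamma>: "\<And>x s. (x, s) \<in> W \<Longrightarrow> \<Gamma> (x + s *\<^sub>R \<nu> x, r x) = (x, s)"
    and \<Gamma>': "\<And>y. y \<in> V \<Longrightarrow> (\<Gamma> has_derivative \<Gamma>' y) (at y)"
    by (rule normal_coordinates[OF U(1,2) gr contg gn0[OF U(2)] \<nu>' cont\<nu>' \<nu>p]) (assumption | rule that)+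
  have zero: "r q = 0" if "q \<in> U" "q \<in> frontier \<Omega>" for q
    by (rule defining_function_zero_on_frontier[OF \<Omega> U(1) contr U(4) that])
  obtain e1 where e1: "e1 > 0" "ball (p, 0) e1 \<subseteq> W"
    using W(1,3) openE by blast
  obtain e2 where e2: "e2 > 0" "ball (p, r p) e2 \<subseteq> V"
    using V openE by blast
  obtain e3 where e3: "e3 > 0" "ball p e3 \<subseteq> U"
    using U(1,2) openE by blast
  have "isCont \<nu>' p"
    using cont\<nu>' U(1,2) continuous_on_eq_continuous_at by blast
  then obtain e4 where e4: "e4 > 0" "\<And>x. dist x p < e4 \<Longrightarrow> dist (\<nu>' x) (\<nu>' p) < 1"
    unfolding continuous_at_eps_delta using zero_less_one by blast
  \<comment> \<open>If \<open>z\<close> is within \<open>e\<close> of \<open>p\<close>, a nearest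
    point \<open>q\<close> is within \<open>2 e\<close> of \<open>p\<close> and the signed distance
    is below \<open>e\<close> in absolute value, so \<open>(q, \<delta> z)\<close> is within
    \<open>3 e\<close> of \<open>(p, 0)\<close>. Hence the factor 3 with \<open>e1\<close>.\<close>
  define e where "e = Min {e1 / 3, e2, e3, e4}"
  have e: "e > 0" "e \<le> e1 / 3" "e \<le> e2" "e \<le> e3" "e \<le> e4"
    using e1 e2 e3 e4 by (auto simp: e_def)
  define N where "N = ball p e"
  have NU: "N \<subseteq> U" using e e3 by (auto simp: N_def)
  \<comment> \<open>Projection and signed distance are read off from \<open>\<Gamma>\<close>, since
    a pointwise choice of nearest points would carry no regularity.\<close>
  define P where "P z = fst (\<Gamma> (z, 0))" for z
  define S where "S z = snd (\<Gamma> (z, 0))" for z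
  have key: "\<Gamma> (z, 0) = (q, \<delta> z) \<and> (q, \<delta> z) \<in> W \<and> q \<in> U"
    if z: "z \<in> N" and q: "q \<in> frontier \<Omega>" "\<bar>\<delta> z\<bar> = dist z q" for z q
  proof -
    have zp: "dist z p < e" using z by (simp add: N_def dist_commute)
    have "dist z q \<le> dist z p"
      using infdist_le[OF p, of z] q(2) by (simp add: abs_signed_distance \<delta>_def)
    then have d: "\<bar>\<delta> z\<bar> < e" "dist p q < 2 * e"
      using zp q(2) dist_triangle[of p q z] by (auto simp: dist_commute)
    have "dist (p, 0) (q, \<delta> z) \<le> dist p q + \<bar>\<delta> z\<bar>"
      using sqrt_sum_squares_le_sum_abs[of "dist p q" "\<delta> z"]
      by (simp add: dist_Pair_Pair dist_real_def)
    then have qW: "(q, \<delta> z) \<in> W"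
      using d e(2) e1(2) by (intro subsetD[OF e1(2)]) (simp add: mem_ball)
    then have qU: "q \<in> U" using W(2) by auto
    have "z = q + \<delta> z *\<^sub>R \<nu> q"
      unfolding \<delta>_def \<nu>_def
      by (rule nearest_point_normal[OF \<Omega> U(1) contr U(4) qU q(1) _ gr[OF qU] gn0[OF qU]])
         (use q(2) in \<open>simp add: \<delta>_def\<close>)
    then show ?thesis
      using \<Gamma>[OF qW] zero[OF qU q(1)] qW qU by simp
  qed
  have near: "P z \<in> U \<and> P z \<in> frontier \<Omega> \<and> r (P z) = 0 \<and> \<delta> z = S z \<and> z = P z + S z *\<^sub>R \<nu> (P z)"
    if z: "z \<in> N" for z
  proof -
    have "frontier \<Omega> \<noteq> {}" using p by blast
    then obtain q where q: "q \<in> frontier \<Omega>" "\<bar>\<delta> z\<bar> = dist z q"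
      using nearest_frontier_point unfolding \<delta>_def by metis
    have k: "\<Gamma> (z, 0) = (q, \<delta> z)" "q \<in> U" using key[OF z q] by auto
    have "z = q + \<delta> z *\<^sub>R \<nu> q"
      unfolding \<delta>_def \<nu>_def
      by (rule nearest_point_normal[OF \<Omega> U(1) contr U(4) k(2) q(1) _ gr[OF k(2)] gn0[OF k(2)]])
         (use q(2) in \<open>simp add: \<delta>_def\<close>)
    then show ?thesis
      using k q zero by (simp add: P_def S_def)
  qed
  define \<Delta> where "\<Delta> z h = \<Gamma>' (z, 0) (h, 0)" for z h
  have \<Gamma>der: "((\<lambda>z. \<Gamma> (z, 0)) has_derivative \<Delta> z) (at z)" if "z \<in> N" for z
    unfolding \<Delta>_def[abs_def]
  proof (rule has_derivative_compose[where g = \<Gamma> and f = "\<lambda>z. (z, 0)"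
        and f' = "\<lambda>h. (h, 0)" and g' = "\<Gamma>' (z, 0)"])
    show "((\<lambda>z. (z, 0 :: real)) has_derivative (\<lambda>h. (h, 0))) (at z)"
      by (auto intro!: derivative_eq_intros)
    have "dist (p, r p) (z, 0) < e2"
      using that e zero[OF U(2) p] by (simp add: dist_Pair_Pair N_def)
    then show "(\<Gamma> has_derivative \<Gamma>' (z, 0)) (at (z, 0))"
      using e2(2) by (intro \<Gamma>') auto
  qed
  have Pder: "(P has_derivative (\<lambda>h. fst (\<Delta> z h))) (at z)"
    and Sder: "(S has_derivative (\<lambda>h. snd (\<Delta> z h))) (at z)" if "z \<in> N" for z
    unfolding P_def[abs_def] S_def[abs_def]
    using \<Gamma>der[OF that] by (auto intro: has_derivative_fst has_derivative_snd)
  have \<nu>Pder: "((\<lambda>z. \<nu> (P z)) has_derivative (\<lambda>h. \<nu>' (P z) (fst (\<Delta> z h)))) (at z)" if "z \<in> N" for z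
    by (rule has_derivative_compose[where g = \<nu>, OF Pder[OF that] \<nu>']) (use near that in blast)
  have oN: "open N" by (simp add: N_def)
  \<comment> \<open>Obtained by differentiating the identities
    \<open>z = P z + S z *\<^sub>R \<nu> (P z)\<close> and \<open>r (P z) = 0\<close>, which hold on
    all of \<open>N\<close>.\<close>
  have decomp: "h = fst (\<Delta> z h) + (S z *\<^sub>R \<nu>' (P z) (fst (\<Delta> z h)) + snd (\<Delta> z h) *\<^sub>R \<nu> (P z))"
    and tang: "fst (\<Delta> z h) \<bullet> \<nu> (P z) = 0" if z: "z \<in> N" for z h
  proof -
    have "((\<lambda>z. P z + S z *\<^sub>R \<nu> (P z)) has_derivative
        (\<lambda>h. fst (\<Delta> z h) + (S z *\<^sub>R \<nu>' (P z) (fst (\<Delta> z h)) + snd (\<Delta> z h) *\<^sub>R \<nu> (P z)))) (at z)"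
      by (intro has_derivative_add has_derivative_scaleR Pder Sder \<nu>Pder z)
    then have "((\<lambda>z. z) has_derivative
        (\<lambda>h. fst (\<Delta> z h) + (S z *\<^sub>R \<nu>' (P z) (fst (\<Delta> z h)) + snd (\<Delta> z h) *\<^sub>R \<nu> (P z)))) (at z)"
      by (rule has_derivative_transform_within_open[OF _ oN z]) (use near in force)
    from has_derivative_unique[OF has_derivative_ident this]
    show "h = fst (\<Delta> z h) + (S z *\<^sub>R \<nu>' (P z) (fst (\<Delta> z h)) + snd (\<Delta> z h) *\<^sub>R \<nu> (P z))"
      by (rule fun_cong)
    have PU: "P z \<in> U" using near z by blast
    have "((\<lambda>z. r (P z)) has_derivative (\<lambda>h. fst (\<Delta> z h) \<bullet> gradient r (P z))) (at z)"
      by (rule has_derivative_compose[where g = r, OF Pder[OF z] gr[OF PU, unfolded gderiv_def]])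
    then have "((\<lambda>z. 0) has_derivative (\<lambda>h. fst (\<Delta> z h) \<bullet> gradient r (P z))) (at z)"
      by (rule has_derivative_transform_within_open[OF _ oN z]) (use near in force)
    from has_derivative_unique[OF this has_derivative_const]
    have "fst (\<Delta> z h) \<bullet> gradient r (P z) = 0"
      by (rule fun_cong)
    then show "fst (\<Delta> z h) \<bullet> \<nu> (P z) = 0"
      by (simp add: \<nu>_def)
  qed
  \<comment> \<open>Pairing \<open>decomp\<close> with \<open>\<nu> (P z)\<close> removes the
    tangential terms, so the gradient of \<open>S\<close> is \<open>\<nu> (P z)\<close>.\<close>
  have snd_eq: "snd (\<Delta> z h) = h \<bullet> \<nu> (P z)" if z: "z \<in> N" for z h
  proof -
    have PU: "P z \<in> U" using near z by blast
    have "h \<bullet> \<nu> (P z) = (fst (\<Delta> z h) + (S z *\<^sub>R \<nu>' (P z) (fst (\<Delta> z h)) + snd (\<Delta> z h) *\<^sub>R \<nu> (P z)))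
        \<bullet> \<nu> (P z)"
      using decomp[OF z, of h] by (rule arg_cong)
    also have "\<dots> = snd (\<Delta> z h)"
      using tang[OF z] orth[OF PU, of "fst (\<Delta> z h)"] \<nu>1[OF PU]
      by (simp add: inner_add_left inner_commute[of "\<nu>' (P z) (fst (\<Delta> z h))"] dot_square_norm)
    finally show ?thesis by simp
  qed
  show ?thesis
  proof (rule that[of N "\<lambda>z. \<nu> (P z)" "\<lambda>z h. \<nu>' (P z) (fst (\<Delta> z h))" "norm (\<nu>' p) + 1"])
    show "open N" "N \<subseteq> U" using oN NU by auto
    show "p \<in> N" using e by (simp add: N_def)
    show "GDERIV (signed_distance \<Omega>) z :> \<nu> (P z)" if z: "z \<in> N" for z
    proof -
      have "(S has_derivative (\<lambda>h. h \<bullet> \<nu> (P z))) (at z)"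
        using Sder[OF z] snd_eq[OF z] by simp
      then show ?thesis
        unfolding gderiv_def
        by (rule has_derivative_transform_within_open[OF _ oN z]) (metis near \<delta>_def)
    qed
    show "((\<lambda>z. \<nu> (P z)) has_derivative (\<lambda>h. \<nu>' (P z) (fst (\<Delta> z h)))) (at z)" if "z \<in> N" for z
      by (rule \<nu>Pder[OF that])
    show "norm (\<nu> (P z)) = 1" if "z \<in> N" for z
      using near[OF that] \<nu>1 by blast
    fix q assume "q \<in> N \<inter> frontier \<Omega>"
    then have q: "q \<in> N" "q \<in> frontier \<Omega>" "q \<in> U" using NU by auto
    have \<delta>q: "\<delta> q = 0" using q by (simp add: \<delta>_def)
    then have "\<Gamma> (q, 0) = (q, 0)"
      using key[OF q(1,2)] by simp
    then have Pq: "P q = q" "S q = 0" by (simp_all add: P_def S_def)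
    show "gradient r q = norm (gradient r q) *\<^sub>R \<nu> (P q)"
      unfolding Pq by (rule \<nu>g[OF q(3)])
    fix h
    define a where "a = fst (\<Delta> q h)"
    define c where "c = snd (\<Delta> q h)"
    \<comment> \<open>At a boundary point \<open>S q = 0\<close>, so this is an orthogonal splitting
      of \<open>h\<close> into tangential and normal parts, and the Hessian sees only
      \<open>a\<close>, with \<open>norm a \<le> norm h\<close>.\<close>
    have h: "h = a + c *\<^sub>R \<nu> q"
      using decomp[OF q(1), of h] unfolding Pq a_def c_def scaleR_zero_left add_0_left .
    have "a \<bullet> \<nu> q = 0"
      using tang[OF q(1), of h] unfolding Pq a_def .
    then have "orthogonal a (c *\<^sub>R \<nu> q)"
      by (simp add: orthogonal_def)
    then have "(norm h)\<^sup>2 = (norm a)\<^sup>2 + (norm (c *\<^sub>R \<nu> q))\<^sup>2"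
      unfolding h by (rule norm_add_Pythagorean)
    then have ah: "norm a \<le> norm h"
      by (intro power2_le_imp_le[of "norm a" "norm h"]) auto
    have "dist q p < e4" using q(1) e by (simp add: N_def dist_commute)
    then have "norm (\<nu>' q) \<le> norm (\<nu>' p) + 1"
      using e4(2)[of q] norm_triangle_sub[of "\<nu>' q" "\<nu>' p"] by (simp add: dist_norm)
    then have "norm (\<nu>' q a) \<le> (norm (\<nu>' p) + 1) * norm h"
      using ah by (intro order_trans[OF norm_blinfun] mult_mono) auto
    then have "norm (\<nu>' q a) * norm h \<le> (norm (\<nu>' p) + 1) * norm h * norm h"
      by (intro mult_right_mono) auto
    then show "\<bar>\<nu>' (P q) (fst (\<Delta> q h)) \<bullet> h\<bar> \<le> (norm (\<nu>' p) + 1) * (norm h)\<^sup>2"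
      using Cauchy_Schwarz_ineq2[of "\<nu>' q a" h] by (simp add: Pq a_def power2_eq_square mult.assoc)
  qed
qed

section \<open>The complex Hessian form\<close>

lemma inner_i_i:
  fixes A B :: "complex ^ 'n"
  shows "(\<i> *s A) \<bullet> (\<i> *s B) = A \<bullet> B"
  by (simp add: inner_vec_def inner_complex_def add.commute)

lemma i_i_mult:
  fixes A :: "complex ^ 'n"
  shows "\<i> *s (\<i> *s A) = - A"
  by (simp add: vec_eq_iff flip: mult.assoc)

lemma inner_i_left:
  fixes A B :: "complex ^ 'n"
  shows "(\<i> *s A) \<bullet> B = - (A \<bullet> (\<i> *s B))"
  using inner_i_i[of A "\<i> *s B"] inner_i_i[of "\<i> *s A" B] by (simp add: i_i_mult)

lemma inner_i_self:
  fixes A :: "complex ^ 'n"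
  shows "A \<bullet> (\<i> *s A) = 0" "(\<i> *s A) \<bullet> A = 0"
  using inner_i_left[of A A] by (simp_all add: inner_commute)

lemma norm_i:
  fixes A :: "complex ^ 'n"
  shows "norm (\<i> *s A) = norm A"
  by (simp add: norm_eq_sqrt_inner inner_i_i)

lemma inner_vec_axis:
  fixes A :: "complex ^ 'n"
  shows "axis k 1 \<bullet> A = Re (A $ k)" "axis k \<i> \<bullet> A = Im (A $ k)"
  by (simp_all add: inner_axis' inner_complex_def)

text \<open>For a real Hessian \<open>H\<close> this is four times the Levi form of the underlying
  function on the diagonal, expressed without coordinates.\<close>

definition hermitian_form :: "(complex ^ 'n \<Rightarrow> complex ^ 'n) \<Rightarrow> complex ^ 'n \<Rightarrow> real" where
  "hermitian_form H A = H A \<bullet> A + H (\<i> *s A) \<bullet> (\<i> *s A)"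

lemma wirtinger_bar_of_gradient:
  fixes f :: "complex ^ 'n \<Rightarrow> real"
  assumes "GDERIV f w :> D"
  shows "wirtinger_bar l (\<lambda>z. complex_of_real (f z)) w = (D $ l) / 2"
proof -
  have "((\<lambda>z. complex_of_real (f z)) has_derivative (\<lambda>h. complex_of_real (h \<bullet> D))) (at w)"
    using assms unfolding gderiv_def by (rule has_derivative_of_real)
  then have "frechet_derivative (\<lambda>z. complex_of_real (f z)) (at w) = (\<lambda>h. complex_of_real (h \<bullet> D))"
    by (rule frechet_derivative_at[symmetric])
  then show ?thesis
    by (simp add: wirtinger_bar_def inner_vec_axis complex_eq_iff)
qed

text \<open>The conjugate Wirtinger derivatives are half the components of the gradient, so one more
  differentiation expresses everything through \<open>H\<close>. The real part of the resulting sum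
  is the form; the imaginary part vanishes by symmetry of \<open>H\<close>.\<close>

lemma complex_hessian_eq_hermitian_form:
  fixes f :: "complex ^ 'n \<Rightarrow> real"
  assumes "open N" "z \<in> N" and f: "\<And>w. w \<in> N \<Longrightarrow> GDERIV f w :> n w"
    and n: "(n has_derivative H) (at z)"
  shows "complex_hessian f z A A = complex_of_real (hermitian_form H A / 4)"
proof -
  have lin: "linear H" using n by (rule has_derivative_linear)
  have sym: "H u \<bullet> v = H v \<bullet> u" for u v
    by (rule gradient_derivative_symmetric[OF assms])
  have W: "wirtinger k (wirtinger_bar l (\<lambda>z. complex_of_real (f z))) z
      = (H (axis k 1) $ l - \<i> * H (axis k \<i>) $ l) / 4" for k l
  proof -
    have "((\<lambda>w. (n w $ l) / 2) has_derivative (\<lambda>h. (H h $ l) / 2)) (at z)"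
      by (intro bounded_linear.has_derivative[OF bounded_linear_divide]
          bounded_linear.has_derivative[OF bounded_linear_vec_nth] n)
    then have "(wirtinger_bar l (\<lambda>z. complex_of_real (f z)) has_derivative (\<lambda>h. (H h $ l) / 2)) (at z)"
      by (rule has_derivative_transform_within_open[OF _ assms(1,2)])
         (simp add: wirtinger_bar_of_gradient[OF f])
    then have "frechet_derivative (wirtinger_bar l (\<lambda>z. complex_of_real (f z))) (at z)
        = (\<lambda>h. (H h $ l) / 2)"
      by (rule frechet_derivative_at[symmetric])
    then show ?thesis
      by (simp add: wirtinger_def field_simps)
  qed
  \<comment> \<open>Although \<open>H\<close> is only real linear,
    \<open>B \<mapsto> H B - \<i> H (\<i> B)\<close> is complex linear, so the factor
    \<open>A $ k\<close> can be moved into the argument.\<close>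
  have col: "(H (axis k 1) $ l - \<i> * H (axis k \<i>) $ l) * A $ k
      = H (axis k (A $ k)) $ l - \<i> * H (axis k (\<i> * A $ k)) $ l" for k l
  proof -
    have ax: "axis k c = Re c *\<^sub>R axis k 1 + Im c *\<^sub>R axis k \<i>" for c :: complex
      by (simp add: vec_eq_iff axis_def complex_eq_iff)
    have Hax: "H (axis k c) = Re c *\<^sub>R H (axis k 1) + Im c *\<^sub>R H (axis k \<i>)" for c :: complex
      by (subst ax) (simp only: linear_add[OF lin] linear_cmul[OF lin])
    show ?thesis
      unfolding Hax[of "A $ k"] Hax[of "\<i> * A $ k"]
      by (simp add: complex_eq_iff algebra_simps)
  qed
  have sum_axis: "(\<Sum>k\<in>UNIV. H (axis k (B $ k))) = H B" for B
  proof -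
    have "(\<Sum>k\<in>UNIV. axis k (B $ k)) = B"
      by (simp add: vec_eq_iff axis_def if_distrib sum.delta cong: if_cong)
    then show ?thesis
      by (metis linear_sum[OF lin])
  qed
  have row: "(\<Sum>k\<in>UNIV. (H (axis k 1) $ l - \<i> * H (axis k \<i>) $ l) * A $ k)
      = H A $ l - \<i> * H (\<i> *s A) $ l" for l
    unfolding col sum_subtractf using sum_axis[of A] sum_axis[of "\<i> *s A"]
    by (simp flip: sum_distrib_left sum_component)
  have "complex_hessian f z A A
      = (\<Sum>l\<in>UNIV. \<Sum>k\<in>UNIV. (H (axis k 1) $ l - \<i> * H (axis k \<i>) $ l) / 4 * A $ k * cnj (A $ l))"
    unfolding complex_hessian_def W by (rule sum.swap)
  also have "\<dots> = (\<Sum>l\<in>UNIV. (\<Sum>k\<in>UNIV. (H (axis k 1) $ l - \<i> * H (axis k \<i>) $ l) * A $ k)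
      * cnj (A $ l)) / 4"
    by (simp add: sum_distrib_right sum_divide_distrib)
  also have "\<dots> = (\<Sum>l\<in>UNIV. (H A $ l - \<i> * H (\<i> *s A) $ l) * cnj (A $ l)) / 4"
    unfolding row ..
  finally have eq: "complex_hessian f z A A
      = (\<Sum>l\<in>UNIV. (H A $ l - \<i> * H (\<i> *s A) $ l) * cnj (A $ l)) / 4" .
  have re: "Re (\<Sum>l\<in>UNIV. (H A $ l - \<i> * H (\<i> *s A) $ l) * cnj (A $ l)) = hermitian_form H A"
    by (simp add: hermitian_form_def inner_vec_def inner_complex_def algebra_simps flip: sum.distrib)
  have "Im (\<Sum>l\<in>UNIV. (H A $ l - \<i> * H (\<i> *s A) $ l) * cnj (A $ l))
      = H A \<bullet> (\<i> *s A) - H (\<i> *s A) \<bullet> A"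
    by (simp add: inner_vec_def inner_complex_def algebra_simps flip: sum_subtractf)
  also have "\<dots> = 0" using sym[of A "\<i> *s A"] by simp
  finally show ?thesis
    unfolding eq using re by (simp add: complex_eq_iff)
qed

text \<open>With \<open>c = x + \<i> y\<close> the form scales by
  \<open>\<bar>c\<bar>\<^sup>2\<close>, the mixed terms cancelling between its two summands. This
  carries nonnegativity from a rotated vector back to the original one.\<close>

lemma hermitian_form_complex_scale:
  assumes "linear H"
  shows "hermitian_form H (x *\<^sub>R A + y *\<^sub>R (\<i> *s A)) = (x\<^sup>2 + y\<^sup>2) * hermitian_form H A"
proof -
  have i: "\<i> *s (x *\<^sub>R A + y *\<^sub>R (\<i> *s A)) = x *\<^sub>R (\<i> *s A) - y *\<^sub>R A"
    by (simp add: vec_eq_iff complex_eq_iff)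
  show ?thesis
    unfolding hermitian_form_def i linear_add[OF assms] linear_diff[OF assms] linear_cmul[OF assms]
    by (simp add: inner_diff_left inner_diff_right inner_add_left inner_add_right power2_eq_square
        algebra_simps)
qed

text \<open>Composing a function with a function of one real variable changes its Hessian in this
  way, \<open>n\<close> being the gradient.\<close>

lemma hermitian_form_add_rank_one:
  "hermitian_form (\<lambda>h. a *\<^sub>R H h + (b * (h \<bullet> n)) *\<^sub>R n) A
    = a * hermitian_form H A + b * ((A \<bullet> n)\<^sup>2 + ((\<i> *s A) \<bullet> n)\<^sup>2)"
  by (simp add: hermitian_form_def inner_add_left inner_commute power2_eq_square algebra_simps)

text \<open>For \<open>A = c n + W\<close> with \<open>c = a - \<i>b\<close> and \<open>W\<close> in the complex tangent space, \<open>V = - \<i> c\<^sup>* A\<close> is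
  real tangential; the hypothesis on \<open>A\<close> says \<open>\<bar>c\<bar> \<le> \<gamma> \<parallel>W\<parallel>\<close>.\<close>

lemma rotate_into_tangent_cone:
  fixes A n :: "complex ^ 'n"
  assumes r: "local_defining_function \<Omega> p U r"
    and n: "norm n = 1" "gradient r p = norm (gradient r p) *\<^sub>R n" and "\<gamma> \<ge> 0"
    and A: "(A \<bullet> n)\<^sup>2 + ((\<i> *s A) \<bullet> n)\<^sup>2
            \<le> \<gamma>\<^sup>2 * ((norm A)\<^sup>2 - ((A \<bullet> n)\<^sup>2 + ((\<i> *s A) \<bullet> n)\<^sup>2))"
  shows "\<exists>x y. x\<^sup>2 + y\<^sup>2 > 0 \<and> x *\<^sub>R A + y *\<^sub>R (\<i> *s A) \<in> tangent_cone \<Omega> \<gamma> p"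
proof -
  define g where "g = gradient r p"
  define a where "a = A \<bullet> n"
  define b where "b = (\<i> *s A) \<bullet> n"
  have "g \<noteq> 0" using r by (auto simp: local_defining_function_def g_def)
  then have ng: "norm g > 0" by simp
  have g: "g = norm g *\<^sub>R n" unfolding g_def by (rule n(2))
  have ig: "\<i> *s g = norm g *\<^sub>R (\<i> *s n)"
    by (subst g) (simp add: vec_eq_iff complex_eq_iff)
  \<comment> \<open>The cone condition rewritten for the unit normal: the factors
    \<open>norm g\<close> cancel, and squaring turns the norm of the difference into a Pythagorean
    difference.\<close>
  have cone: "V \<in> tangent_cone \<Omega> \<gamma> p"
    if tan: "V \<bullet> n = 0" and le: "((\<i> *s n) \<bullet> V)\<^sup>2 \<le> \<gamma>\<^sup>2 * ((norm V)\<^sup>2 - ((\<i> *s n) \<bullet> V)\<^sup>2)" for V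
  proof -
    define t where "t = (\<i> *s n) \<bullet> V"
    have 1: "V \<in> real_tangent_space r p"
    proof -
      have "g \<bullet> V = norm g * (n \<bullet> V)" by (subst g) simp
      then show ?thesis
        using tan by (simp add: real_tangent_space_def g_def inner_commute)
    qed
    have 2: "\<bar>(\<i> *s g) \<bullet> V\<bar> / norm g = \<bar>t\<bar>"
      using ng by (simp add: ig t_def abs_mult)
    have 3: "(((\<i> *s g) \<bullet> V) / (norm g)\<^sup>2) *\<^sub>R (\<i> *s g) = t *\<^sub>R (\<i> *s n)"
      using ng by (simp add: ig t_def power2_eq_square)
    have "(norm (V - t *\<^sub>R (\<i> *s n)))\<^sup>2 = (norm V)\<^sup>2 - t\<^sup>2"
    proof -
      have "(norm (\<i> *s n))\<^sup>2 = 1" using n(1) by (simp add: norm_i)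
      then have "(\<i> *s n) \<bullet> (\<i> *s n) = 1" by (simp add: dot_square_norm)
      then show ?thesis
        unfolding power2_norm_eq_inner
        by (simp add: inner_diff_left inner_diff_right inner_commute[of V "\<i> *s n"] power2_eq_square
            flip: t_def)
    qed
    then have "\<bar>t\<bar>\<^sup>2 \<le> (\<gamma> * norm (V - t *\<^sub>R (\<i> *s n)))\<^sup>2"
      using le by (simp add: power_mult_distrib t_def)
    then have "\<bar>t\<bar> \<le> \<gamma> * norm (V - t *\<^sub>R (\<i> *s n))"
      using assms(4) by (rule power2_le_imp_le[OF _ mult_nonneg_nonneg]) simp
    then have "\<bar>(\<i> *s g) \<bullet> V\<bar> / norm g
        \<le> \<gamma> * norm (V - (((\<i> *s g) \<bullet> V) / (norm g)\<^sup>2) *\<^sub>R (\<i> *s g))"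
      unfolding 2 3 .
    then show ?thesis
      unfolding tangent_cone_def g_def using r 1 by blast
  qed
  have inA: "(\<i> *s n) \<bullet> A = - b"
    unfolding b_def inner_i_left[of n A] by (simp add: inner_commute)
  \<comment> \<open>If \<open>A\<close> has no complex normal component, it lies in the cone
    already, whereas the rotated vector \<open>V\<close> below would be zero.\<close>
  show ?thesis
  proof (cases "a\<^sup>2 + b\<^sup>2 = 0")
    case True
    then have "a = 0" "b = 0" by (auto simp: sum_power2_eq_zero_iff)
    then have "A \<in> tangent_cone \<Omega> \<gamma> p"
      using inA A by (intro cone) (simp_all add: a_def b_def)
    then show ?thesis
      by (intro exI[of _ 1] exI[of _ 0]) simp
  next
    case False
    define C where "C = a\<^sup>2 + b\<^sup>2"
    have C: "C > 0" using False by (simp add: C_def sum_power2_gt_zero_iff)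
    define V where "V = b *\<^sub>R A + (- a) *\<^sub>R (\<i> *s A)"
    have tan: "V \<bullet> n = 0"
      by (simp add: V_def inner_diff_left a_def b_def)
    have "(\<i> *s n) \<bullet> (\<i> *s A) = a"
      by (simp add: inner_i_i a_def inner_commute)
    then have t: "(\<i> *s n) \<bullet> V = - C"
      using inA by (simp add: V_def inner_diff_right C_def power2_eq_square)
    have nV: "(norm V)\<^sup>2 = C * (norm A)\<^sup>2"
      unfolding power2_norm_eq_inner V_def
      by (simp add: inner_diff_left inner_diff_right inner_i_i inner_i_self C_def power2_eq_square
          algebra_simps)
    have "C * C \<le> C * (\<gamma>\<^sup>2 * ((norm A)\<^sup>2 - C))"
      using A C by (intro mult_left_mono) (simp_all add: C_def a_def b_def)
    then have "(- C)\<^sup>2 \<le> \<gamma>\<^sup>2 * (C * (norm A)\<^sup>2 - (- C)\<^sup>2)"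
      by (simp add: power2_eq_square algebra_simps)
    then have "V \<in> tangent_cone \<Omega> \<gamma> p"
      by (intro cone tan) (simp add: t nV)
    then show ?thesis
      using C by (intro exI[of _ b] exI[of _ "- a"]) (simp add: V_def C_def add.commute)
  qed
qed

text \<open>Since \<open>\<delta>\<close> is 1-Lipschitz, \<open>h \<mapsto> \<delta> (z + h) - \<delta> (p + h)\<close> is minimal at \<open>h = 0\<close>: the real
  Hessian of \<open>\<delta>\<close> grows along inward normals.\<close>

lemma signed_distance_hessian_mono:
  fixes \<Omega> :: "'a::euclidean_space set"
  assumes "open N" "z \<in> N" "p \<in> N"
    and der: "\<And>w. w \<in> N \<Longrightarrow> GDERIV (signed_distance \<Omega>) w :> n w"
    and H: "\<And>w. w \<in> N \<Longrightarrow> (n has_derivative H w) (at w)"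
    and z: "z \<in> \<Omega>" and p: "p \<in> frontier \<Omega>" "\<bar>signed_distance \<Omega> z\<bar> = dist z p"
  shows "n z = n p" "H p h \<bullet> h \<le> H z h \<bullet> h"
proof -
  define f where "f k = signed_distance \<Omega> (z + k) - signed_distance \<Omega> (p + k)" for k
  define N' where "N' = (\<lambda>k. z + k) -` N \<inter> (\<lambda>k. p + k) -` N"
  have N': "open N'" "0 \<in> N'"
    unfolding N'_def using assms(1-3) by (auto intro!: open_Int open_vimage continuous_intros)
  have shift: "((\<lambda>k. F (w + k)) has_derivative D) (at k)"
    if "(F has_derivative D) (at (w + k))" for F :: "'a \<Rightarrow> 'c::real_normed_vector" and w k D
    by (rule has_derivative_compose[where g = F and f = "\<lambda>k. w + k" and f' = "\<lambda>h. h", OF _ that])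
       (auto intro!: derivative_eq_intros)
  have f: "GDERIV f k :> n (z + k) - n (p + k)" if "k \<in> N'" for k
    unfolding f_def using that der
    by (intro GDERIV_diff) (auto simp: gderiv_def N'_def intro!: shift)
  have n: "((\<lambda>k. n (z + k) - n (p + k)) has_derivative (\<lambda>h. H z h - H p h)) (at 0)"
    using H[OF assms(2)] H[OF assms(3)] by (intro has_derivative_diff shift) simp_all
  have "signed_distance \<Omega> z = - dist z p"
    using z p(2) by (simp add: signed_distance_def infdist_nonneg)
  then have min: "f 0 \<le> f k" for k
    using signed_distance_le[of \<Omega> "p + k" "z + k"] p(1) by (simp add: f_def dist_commute)
  have "0 \<le> (H z h - H p h) \<bullet> h"
    by (rule second_derivative_nonneg_at_minimum[OF N' f n min])
  then show "H p h \<bullet> h \<le> H z h \<bullet> h"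
    by (simp add: inner_diff_left)
  have "(f has_derivative (\<lambda>h. h \<bullet> (n (z + 0) - n (p + 0)))) (at 0)"
    using f[OF N'(2)] by (simp add: gderiv_def)
  then have "(\<lambda>h. h \<bullet> (n (z + 0) - n (p + 0))) = (\<lambda>h. 0)"
    by (rule differential_zero_maxmin[OF N'(2,1)]) (use min in blast)
  then have "(n z - n p) \<bullet> (n z - n p) = 0"
    by (metis add.right_neutral)
  then show "n z = n p" by simp
qed

section \<open>The complex Hessian of a power of the distance\<close>

text \<open>Chain rule for \<open>\<phi>(x) = - (- x) powr \<eta>\<close>, where
  \<open>\<phi>'\<close> and \<open>\<phi>''\<close> at \<open>f z\<close> are \<open>a\<close> and
  \<open>b\<close>. Since \<open>a\<close> carries one more factor \<open>- f z\<close> than the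
  power in \<open>b\<close>, \<open>\<eta> * (- f z) powr (\<eta> - 2)\<close> can be factored
  out.\<close>

lemma complex_hessian_neg_powr:
  fixes f :: "complex ^ 'n \<Rightarrow> real"
  assumes "open N" "z \<in> N" and f: "\<And>w. w \<in> N \<Longrightarrow> GDERIV f w :> n w"
    and n: "(n has_derivative H) (at z)" and neg: "\<And>w. w \<in> N \<Longrightarrow> f w < 0"
  shows "complex_hessian (\<lambda>w. - ((- f w) powr \<eta>)) z A A = complex_of_real (\<eta> * (- f z) powr (\<eta> - 2) *
    ((- f z) * hermitian_form H A + (1 - \<eta>) * ((A \<bullet> n z)\<^sup>2 + ((\<i> *s A) \<bullet> n z)\<^sup>2)) / 4)"
proof -
  define G where "G w = (\<eta> * (- f w) powr (\<eta> - 1)) *\<^sub>R n w" for w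
  define a where "a = \<eta> * (- f z) powr (\<eta> - 1)"
  define b where "b = \<eta> * (1 - \<eta>) * (- f z) powr (\<eta> - 2)"
  have G: "GDERIV (\<lambda>w. - ((- f w) powr \<eta>)) w :> G w" if "w \<in> N" for w
    unfolding G_def
  proof (rule GDERIV_DERIV_compose[OF f[OF that], where g = "\<lambda>x. - ((- x) powr \<eta>)"])
    show "((\<lambda>x. - ((- x) powr \<eta>)) has_real_derivative \<eta> * (- f w) powr (\<eta> - 1)) (at (f w))"
      using neg[OF that] by (auto intro!: derivative_eq_intros)
  qed
  have G': "(G has_derivative (\<lambda>h. a *\<^sub>R H h + (b * (h \<bullet> n z)) *\<^sub>R n z)) (at z)"
  proof -
    have "((\<lambda>x. \<eta> * (- x) powr (\<eta> - 1)) has_real_derivative b) (at (f z))"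
      using neg[OF assms(2)]
      by (auto intro!: derivative_eq_intros simp: b_def algebra_simps)
    then have "GDERIV (\<lambda>w. \<eta> * (- f w) powr (\<eta> - 1)) z :> b *\<^sub>R n z"
      by (rule GDERIV_DERIV_compose[OF f[OF assms(2)], where g = "\<lambda>x. \<eta> * (- x) powr (\<eta> - 1)"])
    then have c: "((\<lambda>w. \<eta> * (- f w) powr (\<eta> - 1)) has_derivative (\<lambda>h. h \<bullet> (b *\<^sub>R n z))) (at z)"
      by (simp add: gderiv_def)
    show ?thesis
      unfolding G_def[abs_def]
      by (rule has_derivative_eq_rhs[OF has_derivative_scaleR[OF c n]])
         (simp add: fun_eq_iff a_def)
  qed
  have t: "- f z > 0" using neg[OF assms(2)] by simp
  have "(- f z) powr (\<eta> - 1) = (- f z) powr (\<eta> - 2) * (- f z)"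
    using powr_mult_base[of "- f z" "\<eta> - 2"] t by (simp add: mult.commute)
  then have "a * hermitian_form H A + b * ((A \<bullet> n z)\<^sup>2 + ((\<i> *s A) \<bullet> n z)\<^sup>2)
      = \<eta> * (- f z) powr (\<eta> - 2) *
        ((- f z) * hermitian_form H A + (1 - \<eta>) * ((A \<bullet> n z)\<^sup>2 + ((\<i> *s A) \<bullet> n z)\<^sup>2))"
    by (simp add: a_def b_def algebra_simps)
  then show ?thesis
    using complex_hessian_eq_hermitian_form[OF assms(1,2) G G', of A]
    unfolding hermitian_form_add_rank_one by simp
qed

section \<open>Uniform estimates along the whole boundary\<close>

text \<open>Gluing of the local statements. Compactness of the frontier reduces the local bounds on
  the Hessian to finitely many, whose maximum is \<open>M\<close>.\<close>

lemma signed_distance_regular_on_neighborhood: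
  fixes \<Omega> :: "'a::euclidean_space set"
  assumes "smoothly_bounded_domain \<Omega>"
  obtains N n H M where "open N" "frontier \<Omega> \<subseteq> N" "M \<ge> 0"
    and "\<And>z. z \<in> N \<Longrightarrow> GDERIV (signed_distance \<Omega>) z :> n z"
    and "\<And>z. z \<in> N \<Longrightarrow> (n has_derivative H z) (at z)"
    and "\<And>q. q \<in> frontier \<Omega> \<Longrightarrow> norm (n q) = 1"
    and "\<And>q. q \<in> frontier \<Omega> \<Longrightarrow>
      \<exists>U r. local_defining_function \<Omega> q U r \<and> gradient r q = norm (gradient r q) *\<^sub>R n q"
    and "\<And>q h. q \<in> frontier \<Omega> \<Longrightarrow> \<bar>H q h \<bullet> h\<bar> \<le> M * (norm h)\<^sup>2"
proof -
  \<comment> \<open>Fixing the gradient and its derivative globally makes the data from different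
    boundary points agree, by uniqueness of derivatives.\<close>
  define n where "n = gradient (signed_distance \<Omega>)"
  define H where "H z = frechet_derivative n (at z)" for z
  have \<Omega>: "open \<Omega>" "bounded \<Omega>"
    using assms by (auto simp: smoothly_bounded_domain_def)
  have "\<exists>N B. open N \<and> p \<in> N \<and>
      (\<forall>z\<in>N. GDERIV (signed_distance \<Omega>) z :> n z \<and> (n has_derivative H z) (at z)) \<and>
      (\<forall>q\<in>N \<inter> frontier \<Omega>. norm (n q) = 1 \<and>
        (\<exists>U r. local_defining_function \<Omega> q U r \<and> gradient r q = norm (gradient r q) *\<^sub>R n q) \<and>
        (\<forall>h. \<bar>H q h \<bullet> h\<bar> \<le> B * (norm h)\<^sup>2))" (is "\<exists>N B. ?P p N B")
    if p: "p \<in> frontier \<Omega>" for p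
  proof -
    obtain U r where r: "local_defining_function \<Omega> p U r"
      using assms p unfolding smoothly_bounded_domain_def by blast
    obtain N m K B where N: "open N" "p \<in> N" "N \<subseteq> U"
      and m: "\<And>z. z \<in> N \<Longrightarrow> GDERIV (signed_distance \<Omega>) z :> m z"
      and K: "\<And>z. z \<in> N \<Longrightarrow> (m has_derivative K z) (at z)"
      and m1: "\<And>z. z \<in> N \<Longrightarrow> norm (m z) = 1"
      and mr: "\<And>q. q \<in> N \<inter> frontier \<Omega> \<Longrightarrow> gradient r q = norm (gradient r q) *\<^sub>R m q"
      and B: "\<And>q h. q \<in> N \<inter> frontier \<Omega> \<Longrightarrow> \<bar>K q h \<bullet> h\<bar> \<le> B * (norm h)\<^sup>2"
      by (rule signed_distance_regular_near_frontier[OF \<Omega>(1) r p]) (assumption | rule that)+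
    have nm: "n z = m z" if "z \<in> N" for z
      unfolding n_def by (rule gradient_eqI[OF m[OF that]])
    have nK: "(n has_derivative K z) (at z)" if "z \<in> N" for z
      by (rule has_derivative_transform_within_open[OF K[OF that] N(1) that]) (simp add: nm)
    then have HK: "H z = K z" if "z \<in> N" for z
      unfolding H_def using frechet_derivative_at[OF nK[OF that]] by simp
    have rq: "local_defining_function \<Omega> q U r" if "q \<in> N" for q
      using r N(3) that by (auto simp: local_defining_function_def)
    have "?P p N B"
    proof (intro conjI ballI allI)
      fix q assume q: "q \<in> N \<inter> frontier \<Omega>"
      show "\<exists>U r. local_defining_function \<Omega> q U r \<and> gradient r q = norm (gradient r q) *\<^sub>R n q"
        using q rq mr[OF q] nm by (metis IntD1)
      show "norm (n q) = 1"
        using q m1 nm by simp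
      show "\<bar>H q h \<bullet> h\<bar> \<le> B * (norm h)\<^sup>2" for h
        using q B[OF q] HK by simp
    qed (use N(1,2) m nK nm HK in auto)
    then show ?thesis by blast
  qed
  then obtain N B where NB: "\<And>p. p \<in> frontier \<Omega> \<Longrightarrow> ?P p (N p) (B p)"
    by metis
  have "compact (frontier \<Omega>)"
    using \<Omega>(2) by (rule compact_frontier_bounded)
  then obtain F where F: "F \<subseteq> frontier \<Omega>" "finite F" "frontier \<Omega> \<subseteq> (\<Union>p\<in>F. N p)"
    by (rule compactE_image[of _ "frontier \<Omega>" N]) (use NB in auto)
  define M where "M = Max (insert 0 (B ` F))"
  have M: "M \<ge> 0" "\<And>p. p \<in> F \<Longrightarrow> B p \<le> M"
    using F(2) by (auto simp: M_def)
  show ?thesis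
  proof (rule that[of "\<Union>p\<in>frontier \<Omega>. N p" M n H])
    show "open (\<Union>p\<in>frontier \<Omega>. N p)" "frontier \<Omega> \<subseteq> (\<Union>p\<in>frontier \<Omega>. N p)"
      using NB by blast+
    show "GDERIV (signed_distance \<Omega>) z :> n z" "(n has_derivative H z) (at z)"
      if "z \<in> (\<Union>p\<in>frontier \<Omega>. N p)" for z
      using NB that by blast+
    fix q assume q: "q \<in> frontier \<Omega>"
    show "norm (n q) = 1"
      "\<exists>U r. local_defining_function \<Omega> q U r \<and> gradient r q = norm (gradient r q) *\<^sub>R n q"
      using NB[OF q] q by blast+
    fix h
    obtain p where p: "p \<in> F" "q \<in> N p" using F(3) q by blast
    have "\<bar>H q h \<bullet> h\<bar> \<le> B p * (norm h)\<^sup>2"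
      using NB[of p] F(1) p q by blast
    also have "\<dots> \<le> M * (norm h)\<^sup>2"
      using M(2)[OF p(1)] by (intro mult_right_mono) auto
    finally show "\<bar>H q h \<bullet> h\<bar> \<le> M * (norm h)\<^sup>2" .
  qed (rule M(1))
qed

section \<open>Nonnegativity of the complex Hessian near the boundary\<close>

theorem theorem6p14:
  fixes \<Omega> :: "(complex ^ 'n) set" and \<gamma> \<eta> :: real
  assumes "smoothly_bounded_domain \<Omega>"
    and "\<gamma> > 0"
    and "gamma_plurisubharmonic \<gamma> \<Omega>"
    and "\<eta> = 1 - 2 / (2 + \<gamma>\<^sup>2)"
  shows "\<exists>U. open U \<and> frontier \<Omega> \<subseteq> U \<and>
           (\<forall>z\<in>U \<inter> \<Omega>. \<forall>V.
              0 \<le> complex_hessian (\<lambda>w. - ((- signed_distance \<Omega> w) powr \<eta>)) z V V)"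
proof -
  have \<Omega>: "open \<Omega>" "bounded \<Omega>" "\<Omega> \<noteq> {}"
    using assms(1) by (auto simp: smoothly_bounded_domain_def)
  have "\<Omega> \<noteq> UNIV"
    using \<Omega>(2) not_bounded_UNIV by auto
  then have F: "frontier \<Omega> \<noteq> {}"
    using \<Omega>(3) frontier_eq_empty by blast
  have "0 < 2 + \<gamma>\<^sup>2"
    by (simp add: add_pos_nonneg)
  then have \<eta>: "0 \<le> \<eta>" "0 < 1 - \<eta>"
    unfolding assms(4) by (simp_all add: divide_simps)
  obtain N n H M where N: "open N" "frontier \<Omega> \<subseteq> N" and M: "M \<ge> 0"
    and der: "\<And>z. z \<in> N \<Longrightarrow> GDERIV (signed_distance \<Omega>) z :> n z"
    and H: "\<And>z. z \<in> N \<Longrightarrow> (n has_derivative H z) (at z)"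
    and n1: "\<And>q. q \<in> frontier \<Omega> \<Longrightarrow> norm (n q) = 1"
    and nr: "\<And>q. q \<in> frontier \<Omega> \<Longrightarrow>
      \<exists>U r. local_defining_function \<Omega> q U r \<and> gradient r q = norm (gradient r q) *\<^sub>R n q"
    and bound: "\<And>q h. q \<in> frontier \<Omega> \<Longrightarrow> \<bar>H q h \<bullet> h\<bar> \<le> M * (norm h)\<^sup>2"
    by (rule signed_distance_regular_on_neighborhood[OF assms(1)]) (assumption | rule that)+
  \<comment> \<open>Outside the cone \<open>(norm A)\<^sup>2\<close> is at most
    \<open>(1 + \<gamma>\<^sup>2) / \<gamma>\<^sup>2 * c\<close>, with \<open>c\<close> the squared
    modulus of the complex normal component. With the bound \<open>2 * M\<close> for the form at the
    boundary, this makes the form at least \<open>- (K * c)\<close>; on \<open>U\<close> the term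
    \<open>(1 - \<eta>) * c\<close> compensates for \<open>t\<close> times that.\<close>
  define K where "K = 2 * M * (1 + \<gamma>\<^sup>2) / \<gamma>\<^sup>2"
  define U where "U = N \<inter> {z. infdist z (frontier \<Omega>) * K < 1 - \<eta>}"
  have "open U"
    unfolding U_def using N(1) by (intro open_Int open_Collect_less continuous_intros)
  moreover have "frontier \<Omega> \<subseteq> U"
    using N(2) \<eta>(2) by (auto simp: U_def)
  moreover have "0 \<le> complex_hessian (\<lambda>w. - ((- signed_distance \<Omega> w) powr \<eta>)) z A A"
    if z: "z \<in> U \<inter> \<Omega>" for z A
  proof -
    have zN: "z \<in> N" "z \<in> \<Omega>" using z by (auto simp: U_def)
    obtain p where p: "p \<in> frontier \<Omega>" "\<bar>signed_distance \<Omega> z\<bar> = dist z p"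
      using nearest_frontier_point[OF F] by metis
    have pN: "p \<in> N" using p N(2) by blast
    note mono = signed_distance_hessian_mono[OF N(1) zN(1) pN der H zN(2) p]
    have nz: "n z = n p" by (rule mono(1))
    define t where "t = - signed_distance \<Omega> z"
    have t: "t > 0" "t * K < 1 - \<eta>"
      using signed_distance_neg[OF \<Omega>(1) F zN(2)] abs_signed_distance[of \<Omega> z] z
      by (auto simp: t_def U_def)
    define c where "c = (A \<bullet> n p)\<^sup>2 + ((\<i> *s A) \<bullet> n p)\<^sup>2"
    have c: "c \<ge> 0" by (simp add: c_def)
    have herm: "hermitian_form (H p) A \<le> hermitian_form (H z) A"
      unfolding hermitian_form_def by (intro add_mono mono(2))
    have "0 \<le> t * hermitian_form (H z) A + (1 - \<eta>) * c"
    proof (cases "c \<le> \<gamma>\<^sup>2 * ((norm A)\<^sup>2 - c)")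
      case True
      obtain U' r where r: "local_defining_function \<Omega> p U' r"
        "gradient r p = norm (gradient r p) *\<^sub>R n p"
        using nr[OF p(1)] by blast
      obtain x y where xy: "x\<^sup>2 + y\<^sup>2 > 0" "x *\<^sub>R A + y *\<^sub>R (\<i> *s A) \<in> tangent_cone \<Omega> \<gamma> p"
        using rotate_into_tangent_cone[OF r(1) n1[OF p(1)] r(2) less_imp_le[OF assms(2)]] True
        unfolding c_def by blast
      \<comment> \<open>The hypothesis speaks only about real tangential vectors, so it is applied
        to a complex multiple of \<open>A\<close>, and the scaling of the form returns to
        \<open>A\<close> itself.\<close>
      define V where "V = x *\<^sub>R A + y *\<^sub>R (\<i> *s A)"
      have "0 \<le> complex_hessian (signed_distance \<Omega>) p V V"
        using assms(3) p(1) xy(2) unfolding gamma_plurisubharmonic_def V_def by blast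
      moreover have "complex_hessian (signed_distance \<Omega>) p V V
          = complex_of_real (hermitian_form (H p) V / 4)"
        by (rule complex_hessian_eq_hermitian_form[OF N(1) pN der H[OF pN]])
      ultimately have "0 \<le> complex_of_real (hermitian_form (H p) V / 4)"
        by metis
      then have "0 \<le> hermitian_form (H p) (x *\<^sub>R A + y *\<^sub>R (\<i> *s A))"
        by (simp add: less_eq_complex_def V_def)
      then have "0 \<le> (x\<^sup>2 + y\<^sup>2) * hermitian_form (H p) A"
        unfolding hermitian_form_complex_scale[OF has_derivative_linear[OF H[OF pN]]] .
      then have "0 \<le> hermitian_form (H p) A"
        using xy(1) by (simp add: zero_le_mult_iff)
      then show ?thesis
        using herm t(1) c \<eta>(2) by (intro add_nonneg_nonneg mult_nonneg_nonneg) auto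
    next
      case False
      then have A: "(norm A)\<^sup>2 \<le> (1 + \<gamma>\<^sup>2) / \<gamma>\<^sup>2 * c"
        using assms(2) by (simp add: field_simps)
      have "- (2 * M * (norm A)\<^sup>2) \<le> hermitian_form (H p) A"
        using bound[OF p(1), of A] bound[OF p(1), of "\<i> *s A"]
        by (simp add: hermitian_form_def norm_i)
      then have "- (2 * M * (norm A)\<^sup>2) \<le> hermitian_form (H z) A"
        using herm by linarith
      moreover have "2 * M * (norm A)\<^sup>2 \<le> 2 * M * ((1 + \<gamma>\<^sup>2) / \<gamma>\<^sup>2 * c)"
        using A M by (intro mult_left_mono) auto
      ultimately have "- (K * c) \<le> hermitian_form (H z) A"
        by (simp add: K_def)
      then have "t * (- (K * c)) \<le> t * hermitian_form (H z) A"
        using t(1) by (intro mult_left_mono) auto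
      moreover have "(t * K) * c \<le> (1 - \<eta>) * c"
        using t(2) c by (intro mult_right_mono) auto
      ultimately show ?thesis
        by (simp add: mult.assoc)
    qed
    then have "0 \<le> \<eta> * t powr (\<eta> - 2) * (t * hermitian_form (H z) A + (1 - \<eta>) * c) / 4"
      using \<eta>(1) by simp
    moreover have "complex_hessian (\<lambda>w. - ((- signed_distance \<Omega> w) powr \<eta>)) z A A
        = complex_of_real (\<eta> * t powr (\<eta> - 2) * (t * hermitian_form (H z) A + (1 - \<eta>) * c) / 4)"
      unfolding t_def c_def nz[symmetric]
    proof (rule complex_hessian_neg_powr[where n = n])
      \<comment> \<open>Inside \<open>\<Omega>\<close> the signed distance is negative, so the real
        power is differentiable there.\<close>
      show "open (N \<inter> \<Omega>)" "z \<in> N \<inter> \<Omega>" using N(1) \<Omega>(1) zN by auto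
      show "signed_distance \<Omega> w < 0" if "w \<in> N \<inter> \<Omega>" for w
        using signed_distance_neg[OF \<Omega>(1) F] that by blast
    qed (use der H zN in auto)
    ultimately show ?thesis
      by (simp only: less_eq_complex_def zero_complex.sel Re_complex_of_real Im_complex_of_real simp_thms)
  qed
  ultimately show ?thesis by blast
qed

end
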